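(* Suppose Assumptions (A1) and (A2) hold and that $E\,\mathcal{W}_1(\mu_0^N,\mu_0)\to 0$ as $N\to\infty$. Then for every $n\ge 0$, $$\lim_{N\to\infty} E\,\mathcal{W}_1(\mu_n^N,\mu_n)=0 .$$
   Context: Setting. Fix integers $d,m\ge1$, a real $d\times d$ matrix $A$ with operator norm $\|A\|=\sup_{x\neq 0}|Ax|/|x|$, a parameter $\delta>0$, a Borel probability measure $\theta$ on $\mathbb{R}^m$, and a measurable map $f:\mathbb{R}^d\times\mathcal{P}_1(\mathbb{R}^d)\times\mathbb{R}^m\to\mathbb{R}^d$. Here $\mathcal{P}_1(\mathbb{R}^d)$ is the set of Borel probability measures $\mu$ on $\mathbb{R}^d$ with $\|\mu\|_1:=\int|x|\,\mu(dx)<\infty$, with the Wasserstein-1 distance $\mathcal{W}_1(\mu,\nu)=\inf E|X-Y|$ (infimum over all pairs of random variables with laws $\mu,\nu$), equivalently $\sup\{|\int\phi\,d\mu-\int\phi\,d\nu|:\phi \text{ 1-Lipschitz}\}$. Particle system: for each $N\ge1$, $\{X_0^{i,N}\}_{i=1}^N$ are exchangeable $\mathbb{R}^d$-valued random variables each with law $\mu_0\in\mathcal{P}_1(\mathbb{R}^d)$; $\{\epsilon_n^i:i\ge1,n\ge1\}$ are i.i.d. $\mathbb{R}^m$-valued with law $\theta$, independent of the initial conditions; and for $n\ge0$, $X_{n+1}^{i,N}=AX_n^{i,N}+\delta f(X_n^{i,N},\mu_n^N,\epsilon_{n+1}^i)$, $i=1,\dots,N$, where $\mu_n^N=\frac1N\sum_{i=1}^N\delta_{X_n^{i,N}}$.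 Nonlinear evolution: for $\mu\in\mathcal{P}_1(\mathbb{R}^d)$, $\Psi(\mu)$ is the law of $AX+\delta f(X,\mu,\epsilon)$ where $(X,\epsilon)$ has law $\mu\otimes\theta$; $\mu_{n+1}=\Psi(\mu_n)$ for $n\ge0$, and $\Psi^n$ denotes the $n$-fold composition. Assumption (A1): $\sigma:=\int D(z)\theta(dz)<\infty$, where $D(z):=\sup\frac{|f(x_1,\mu_1,z)-f(x_2,\mu_2,z)|}{|x_1-x_2|+\mathcal{W}_1(\mu_1,\mu_2)}$, the supremum over $(x_1,\mu_1)\neq(x_2,\mu_2)$ in $\mathbb{R}^d\times\mathcal{P}_1(\mathbb{R}^d)$. Assumption (A2): $c_0:=\int D_1(z)\theta(dz)<\infty$, where $D_1(z):=|f(0,\delta_0,z)|$. *)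

theory Defs
  imports "HOL-Probability.Probability"
begin

definition P1 :: "('a::euclidean_space) measure \<Rightarrow> bool" where
  "P1 \<mu> \<longleftrightarrow> prob_space \<mu> \<and> sets \<mu> = sets borel \<and> (\<integral>\<^sup>+ x. ennreal (norm x) \<partial>\<mu>) < \<infinity>"

definition couplings :: "('a::euclidean_space) measure \<Rightarrow> 'a measure \<Rightarrow> ('a \<times> 'a) measure set" where
  "couplings \<mu> \<nu> = {\<pi>. prob_space \<pi> \<and> sets \<pi> = sets (borel \<Otimes>\<^sub>M borel)
      \<and> distr \<pi> borel fst = \<mu> \<and> distr \<pi> borel snd = \<nu>}"

definition W1 :: "('a::euclidean_space) measure \<Rightarrow> 'a measure \<Rightarrow> ennreal" where
  "W1 \<mu> \<nu> = (INF \<pi>\<in>couplings \<mu> \<nu>. \<integral>\<^sup>+ p. ennreal (dist (fst p) (snd p)) \<partial>\<pi>)"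

text \<open>Empirical measure (1/N) sum_{i<N} delta_{x i} (meaningful for N >= 1).\<close>
definition empirical :: "nat \<Rightarrow> (nat \<Rightarrow> 'a::euclidean_space) \<Rightarrow> 'a measure" where
  "empirical N x = distr (measure_pmf (pmf_of_set {..<N})) borel x"

definition Dlip :: "(real^'d \<Rightarrow> (real^'d) measure \<Rightarrow> 'z \<Rightarrow> real^'d) \<Rightarrow> 'z \<Rightarrow> ennreal" where
  "Dlip f z = (SUP q \<in> {((x1,\<mu>1),(x2,\<mu>2)). P1 \<mu>1 \<and> P1 \<mu>2 \<and> (x1,\<mu>1) \<noteq> (x2,\<mu>2)}.
      (case q of ((x1,\<mu>1),(x2,\<mu>2)) \<Rightarrow>
        ennreal (norm (f x1 \<mu>1 z - f x2 \<mu>2 z)) / (ennreal (dist x1 x2) + W1 \<mu>1 \<mu>2)))"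

definition Psi :: "real^'d^'d \<Rightarrow> real \<Rightarrow> (real^'d \<Rightarrow> (real^'d) measure \<Rightarrow> real^'m \<Rightarrow> real^'d)
    \<Rightarrow> (real^'m) measure \<Rightarrow> (real^'d) measure \<Rightarrow> (real^'d) measure" where
  "Psi A \<delta> f \<theta> \<mu> = distr (\<mu> \<Otimes>\<^sub>M \<theta>) borel (\<lambda>(x,z). A *v x + \<delta> *\<^sub>R f x \<mu> z)"

end

theory Submission
  imports Defs
begin

text \<open>
  A coupling of an empirical measure \<open>(1/N) \<Sum> \<delta>(x i)\<close> with \<open>\<mu>\<close> is the same as a family of
  probability measures \<open>q i\<close> whose average is \<open>\<mu>\<close>. Given the particles \<open>x\<close> at time \<open>n\<close>, take such
  a family with cost close to \<open>W1 (empirical N x) \<mu>\<close>, sample \<open>Z i\<close> from \<open>q i\<close> independently, and move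
  \<open>Z i\<close> by the nonlinear dynamics with the same noise as particle \<open>i\<close>. The particles and their
  companions stay close by the Lipschitz assumption, while the companions are independent with laws
  averaging to \<open>\<Psi>(\<mu>)\<close>. A law of large numbers that is uniform over all families of laws with a
  given average bounds the Wasserstein distance of their empirical measure to \<open>\<Psi>(\<mu>)\<close>. This gives
  \<open>E W1(\<mu>\<^sup>N(n+1), \<mu>(n+1)) \<le> K E W1(\<mu>\<^sup>N(n), \<mu>(n)) + o(1)\<close>, and the claim follows by induction on \<open>n\<close>.
\<close>

section \<open>Wasserstein distance from an empirical measure\<close>

text \<open>The hypothesis on the initial data concerns only their empirical measure, so no i.i.d.
  companion system is given at time 0 that could be followed through all later times. Companions are
  therefore drawn afresh at every step, from a coupling that depends on the current configuration;
  they are independent but not identically distributed, so the usual i.i.d. law of large numbers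
  does not apply to them. The configuration is frozen while the noise is averaged, and integrated
  only afterwards. Hence the near-optimal coupling need not depend measurably on the configuration;
  only the distances themselves must be measurable. In \<open>K\<close>, the operator norm of
  \<open>A\<close> plus 2 \<delta> (\<sigma> + 1), the transport cost enters through the state
  (\<open>A\<close> and \<open>f\<close>) and once more through the measure argument of
  \<open>f\<close>. \<open>K\<close> may exceed 1, which is harmless because \<open>n\<close> is
  fixed as \<open>N\<close> grows. Distances are bounded by explicit couplings with values in
  \<open>ennreal\<close>, so none has to be known finite beforehand.\<close>

lemma measure_eqI_nn_integral:
  assumes "sets M = sets N"
    and "\<And>g. g \<in> borel_measurable M \<Longrightarrow> (\<integral>\<^sup>+ x. g x \<partial>M) = (\<integral>\<^sup>+ x. g x \<partial>N)"
  shows "M = N"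
proof (rule measure_eqI)
  fix B assume B: "B \<in> sets M"
  then have "emeasure M B = (\<integral>\<^sup>+ x. indicator B x \<partial>M)" by simp
  also have "\<dots> = (\<integral>\<^sup>+ x. indicator B x \<partial>N)" using B by (intro assms) simp
  also have "\<dots> = emeasure N B" using B assms(1) by simp
  finally show "emeasure M B = emeasure N B" .
qed fact

lemma sum_ennreal_divide_of_nat:
  assumes "finite I" "N > 0" "\<And>i. i \<in> I \<Longrightarrow> 0 \<le> a i"
  shows "(\<Sum>i\<in>I. ennreal (a i)) / of_nat N = ennreal ((\<Sum>i\<in>I. a i) / real N)"
  using assms by (simp add: sum_ennreal divide_ennreal ennreal_of_nat_eq_real_of_nat sum_nonneg)

lemma ennreal_average_const: "N > 0 \<Longrightarrow> (\<Sum>i<N. c) / of_nat N = (c::ennreal)"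
  by (simp add: mult.commute[of _ c] ennreal_mult_divide_eq)

lemma sets_empirical [simp, measurable_cong]: "sets (empirical N x) = sets borel"
  by (simp add: empirical_def)

lemma prob_space_empirical: "prob_space (empirical N x)"
  unfolding empirical_def by (intro prob_space.prob_space_distr measure_pmf.prob_space_axioms) simp

lemma nn_integral_empirical:
  assumes "N > 0" "g \<in> borel_measurable borel"
  shows "(\<integral>\<^sup>+ z. g z \<partial>empirical N x) = (\<Sum>i<N. g (x i)) / of_nat N"
  using assms unfolding empirical_def
  by (subst nn_integral_distr) (auto simp: nn_integral_pmf_of_set lessThan_empty_iff)

lemma emeasure_empirical:
  assumes "N > 0" "B \<in> sets borel"
  shows "emeasure (empirical N x) B = (\<Sum>i<N. indicator B (x i)) / of_nat N"
  using nn_integral_empirical[OF assms(1), of "indicator B" x] assms(2) by simp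

lemma P1_empirical:
  assumes "N > 0"
  shows "P1 (empirical N x)"
proof -
  have "(\<integral>\<^sup>+ z. ennreal (norm z) \<partial>empirical N x) = ennreal ((\<Sum>i<N. norm (x i)) / real N)"
    using assms by (simp add: nn_integral_empirical sum_ennreal_divide_of_nat[symmetric])
  then show ?thesis by (simp add: P1_def prob_space_empirical)
qed

lemma measurable_empirical:
  assumes N: "N > 0" and Y: "\<And>i. i < N \<Longrightarrow> Y i \<in> borel_measurable M"
  shows "(\<lambda>\<omega>. empirical N (\<lambda>i. Y i \<omega>)) \<in> M \<rightarrow>\<^sub>M prob_algebra borel"
proof (rule measurable_prob_algebraI)
  show "prob_space (empirical N (\<lambda>i. Y i \<omega>))" for \<omega> by (rule prob_space_empirical)
  show "(\<lambda>\<omega>. empirical N (\<lambda>i. Y i \<omega>)) \<in> M \<rightarrow>\<^sub>M subprob_algebra borel"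
  proof (rule measurable_subprob_algebra)
    show "subprob_space (empirical N (\<lambda>i. Y i \<omega>))" for \<omega>
      by (rule prob_space_imp_subprob_space[OF prob_space_empirical])
    show "(\<lambda>\<omega>. emeasure (empirical N (\<lambda>i. Y i \<omega>)) B) \<in> borel_measurable M" if B: "B \<in> sets borel" for B
    proof -
      have "(\<lambda>\<omega>. \<Sum>i<N. indicator B (Y i \<omega>) :: ennreal) \<in> borel_measurable M"
      proof (rule borel_measurable_sum)
        fix i assume "i \<in> {..<N}"
        then have [measurable]: "Y i \<in> borel_measurable M" using Y by auto
        note B[measurable]
        show "(\<lambda>\<omega>. indicator B (Y i \<omega>) :: ennreal) \<in> borel_measurable M" by measurable
      qed
      then show ?thesis by (simp add: emeasure_empirical[OF N B] divide_ennreal_def)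
    qed
  qed simp
qed

text \<open>The family stores a coupling of an empirical measure with \<open>\<nu>\<close> by its
  conditional laws: \<open>q i\<close> is the law of the partner of particle \<open>i\<close>.
  Indexing by particles rather than positions means that coinciding particles cause no trouble and
  that the same family still serves after the particles have moved. Testing against all nonnegative
  Borel functions, not only indicators, makes costs and kernels directly available.\<close>

definition is_mixture ::
    "nat \<Rightarrow> (nat \<Rightarrow> 'a::euclidean_space measure) \<Rightarrow> 'a measure \<Rightarrow> bool" where
  "is_mixture N q \<nu> \<longleftrightarrow>
    (\<forall>i<N. prob_space (q i) \<and> sets (q i) = sets borel) \<and> sets \<nu> = sets borel \<and>
    (\<forall>g\<in>borel_measurable borel.
      (\<integral>\<^sup>+ z. g z \<partial>\<nu>) = (\<Sum>i<N. \<integral>\<^sup>+ z. g z \<partial>q i) / of_nat N)"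

lemma is_mixtureD:
  assumes "is_mixture N q \<nu>"
  shows "i < N \<Longrightarrow> prob_space (q i)" "i < N \<Longrightarrow> sets (q i) = sets borel" "sets \<nu> = sets borel"
    and "g \<in> borel_measurable borel \<Longrightarrow>
      (\<integral>\<^sup>+ z. g z \<partial>\<nu>) = (\<Sum>i<N. \<integral>\<^sup>+ z. g z \<partial>q i) / of_nat N"
  using assms by (auto simp: is_mixture_def)

text \<open>Drawing the index uniformly and then the partner from \<open>q i\<close> gives a
  coupling of the two measures whose cost is the right-hand side.\<close>

lemma W1_empirical_le:
  fixes \<nu> :: "'a::euclidean_space measure"
  assumes N: "N > 0" and mix: "is_mixture N q \<nu>"
  shows "W1 (empirical N y) \<nu> \<le> (\<Sum>i<N. \<integral>\<^sup>+ z. ennreal (dist (y i) z) \<partial>q i) / of_nat N"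
proof -
  \<comment> \<open>The index space is all of \<open>nat\<close>; the point mass at 0 keeps the
    kernel a probability measure at the indices \<open>i \<ge> N\<close>, which carry no
    weight.\<close>
  define K where "K i = distr (if i < N then q i else return borel 0) (borel \<Otimes>\<^sub>M borel) (\<lambda>z. (y i, z))" for i
  define \<pi> where "\<pi> = measure_pmf (pmf_of_set {..<N}) \<bind> K"
  note q = is_mixtureD[OF mix]
  have Ki: "K i \<in> space (prob_algebra (borel \<Otimes>\<^sub>M borel))"
    and m: "(\<lambda>z. (y i, z)) \<in> (if i < N then q i else return borel 0) \<rightarrow>\<^sub>M borel \<Otimes>\<^sub>M borel" for i
  proof -
    have p: "prob_space (if i < N then q i else return borel 0)" using q(1) by (simp add: prob_space_return)
    have "sets (if i < N then q i else return borel 0) = sets borel" using q(2) by simp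
    note eq = measurable_cong_sets[OF this refl]
    show m: "(\<lambda>z. (y i, z)) \<in> (if i < N then q i else return borel 0) \<rightarrow>\<^sub>M borel \<Otimes>\<^sub>M borel"
      unfolding eq by simp
    show "K i \<in> space (prob_algebra (borel \<Otimes>\<^sub>M borel))"
      unfolding K_def space_prob_algebra using prob_space.prob_space_distr[OF p m] by simp
  qed
  have K: "K \<in> measure_pmf (pmf_of_set {..<N}) \<rightarrow>\<^sub>M prob_algebra (borel \<Otimes>\<^sub>M borel)"
    by (rule measurableI) (use Ki in auto)
  have int: "(\<integral>\<^sup>+ p. h p \<partial>\<pi>) = (\<Sum>i<N. \<integral>\<^sup>+ z. h (y i, z) \<partial>q i) / of_nat N"
    if h: "h \<in> borel_measurable (borel \<Otimes>\<^sub>M borel)" for h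
  proof -
    have "(\<integral>\<^sup>+ p. h p \<partial>\<pi>) = (\<integral>\<^sup>+ i. \<integral>\<^sup>+ p. h p \<partial>K i \<partial>measure_pmf (pmf_of_set {..<N}))"
      unfolding \<pi>_def by (rule nn_integral_bind[OF h measurable_prob_algebraD[OF K]])
    also have "\<dots> = (\<Sum>i<N. \<integral>\<^sup>+ p. h p \<partial>K i) / of_nat N"
      using N by (subst nn_integral_pmf_of_set) (auto simp: lessThan_empty_iff)
    also have "(\<Sum>i<N. \<integral>\<^sup>+ p. h p \<partial>K i) = (\<Sum>i<N. \<integral>\<^sup>+ z. h (y i, z) \<partial>q i)"
    proof (intro sum.cong refl)
      fix i assume "i \<in> {..<N}"
      then have "K i = distr (q i) (borel \<Otimes>\<^sub>M borel) (\<lambda>z. (y i, z))"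
        and "(\<lambda>z. (y i, z)) \<in> q i \<rightarrow>\<^sub>M borel \<Otimes>\<^sub>M borel"
        using m[of i] by (simp_all add: K_def)
      then show "(\<integral>\<^sup>+ p. h p \<partial>K i) = (\<integral>\<^sup>+ z. h (y i, z) \<partial>q i)"
        using nn_integral_distr[of _ "q i" _ h] h by simp
    qed
    finally show ?thesis .
  qed
  have \<pi>: "\<pi> \<in> space (prob_algebra (borel \<Otimes>\<^sub>M borel))"
    unfolding \<pi>_def using K
    by (auto simp: space_prob_algebra measure_pmf.prob_space_axioms
      intro!: prob_space_bind'[where N="borel \<Otimes>\<^sub>M borel" and M="measure_pmf (pmf_of_set {..<N})"]
        sets_bind'[where N="borel \<Otimes>\<^sub>M borel" and M="measure_pmf (pmf_of_set {..<N})"])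
  then have sets_\<pi>[measurable_cong]: "sets \<pi> = sets (borel \<Otimes>\<^sub>M borel)" and pr: "prob_space \<pi>"
    by (auto simp: space_prob_algebra)
  have "distr \<pi> borel fst = empirical N y"
  proof (rule measure_eqI_nn_integral)
    fix g :: "'a \<Rightarrow> ennreal" assume "g \<in> borel_measurable (distr \<pi> borel fst)"
    then have [measurable]: "g \<in> borel_measurable borel" by simp
    have "(\<Sum>i<N. \<integral>\<^sup>+ z. g (y i) \<partial>q i) = (\<Sum>i<N. g (y i))"
      using q(1) by (intro sum.cong) (auto simp: prob_space.emeasure_space_1)
    then show "(\<integral>\<^sup>+ x. g x \<partial>distr \<pi> borel fst) = (\<integral>\<^sup>+ x. g x \<partial>empirical N y)"
      by (subst nn_integral_distr) (auto simp: int nn_integral_empirical[OF N])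
  qed simp
  moreover have "distr \<pi> borel snd = \<nu>"
  proof (rule measure_eqI_nn_integral)
    fix g :: "'a \<Rightarrow> ennreal" assume "g \<in> borel_measurable (distr \<pi> borel snd)"
    then have [measurable]: "g \<in> borel_measurable borel" by simp
    then show "(\<integral>\<^sup>+ x. g x \<partial>distr \<pi> borel snd) = (\<integral>\<^sup>+ x. g x \<partial>\<nu>)"
      by (subst nn_integral_distr) (auto simp: int q(4))
  qed (simp add: q(3))
  ultimately have "\<pi> \<in> couplings (empirical N y) \<nu>"
    using sets_\<pi> pr by (simp add: couplings_def)
  then have "W1 (empirical N y) \<nu> \<le> (\<integral>\<^sup>+ p. ennreal (dist (fst p) (snd p)) \<partial>\<pi>)"
    unfolding W1_def by (rule INF_lower)
  also have "\<dots> = (\<Sum>i<N. \<integral>\<^sup>+ z. ennreal (dist (y i) z) \<partial>q i) / of_nat N"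
    by (subst int) auto
  finally show ?thesis .
qed

text \<open>The first marginal has finite support, so conditioning on the first coordinate is
  elementary: restrict \<open>\<pi>\<close> to \<open>fst p = x i\<close> and normalise.\<close>

lemma couplings_empirical_mixture:
  fixes \<nu> :: "'a::euclidean_space measure"
  assumes N: "N > 0" and \<pi>: "\<pi> \<in> couplings (empirical N x) \<nu>"
  shows "\<exists>q. is_mixture N q \<nu> \<and>
    (\<Sum>i<N. \<integral>\<^sup>+ z. ennreal (dist (x i) z) \<partial>q i) / of_nat N
      = (\<integral>\<^sup>+ p. ennreal (dist (fst p) (snd p)) \<partial>\<pi>)"
proof -
  have s[measurable_cong]: "sets \<pi> = sets (borel \<Otimes>\<^sub>M borel)" and f: "distr \<pi> borel fst = empirical N x"
    and sn: "distr \<pi> borel snd = \<nu>" using \<pi> by (auto simp: couplings_def)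
  \<comment> \<open>Several particles may sit at one site, so the atom at \<open>x i\<close> has
    mass \<open>c (x i) / N\<close>. The weight \<open>w\<close> divides by this mass, and particles
    at the same site receive the same law.\<close>
  define c where "c v = card {j. j < N \<and> x j = v}" for v
  have c_pos: "c (x i) > 0" if "i < N" for i
    using that unfolding c_def by (subst card_gt_0_iff) auto
  define w where "w i p = ennreal (real N / real (c (x i))) * indicator {x i} (fst p)" for i and p :: "'a \<times> 'a"
  have [measurable]: "w i \<in> borel_measurable (borel \<Otimes>\<^sub>M borel)" for i unfolding w_def by measurable
  define q where "q i = distr (density \<pi> (w i)) borel snd" for i
  have intq: "(\<integral>\<^sup>+ z. g z \<partial>q i) = (\<integral>\<^sup>+ p. w i p * g (snd p) \<partial>\<pi>)"
    if [measurable]: "g \<in> borel_measurable borel" for g i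
    unfolding q_def by (subst nn_integral_distr, measurable, subst nn_integral_density) auto
  have fst_int: "(\<integral>\<^sup>+ p. g (fst p) \<partial>\<pi>) = (\<Sum>i<N. g (x i)) / of_nat N"
    if [measurable]: "g \<in> borel_measurable borel" for g :: "'a \<Rightarrow> ennreal"
  proof -
    have "(\<integral>\<^sup>+ p. g (fst p) \<partial>\<pi>) = (\<integral>\<^sup>+ z. g z \<partial>distr \<pi> borel fst)" by (subst nn_integral_distr) auto
    then show ?thesis unfolding f by (simp add: nn_integral_empirical[OF N])
  qed
  have card: "(\<Sum>i<N. indicator {v} (x i) :: ennreal) = of_nat (c v)" for v
  proof -
    have "(\<Sum>i<N. indicator {v} (x i) :: ennreal) = (\<Sum>i\<in>{..<N}. if x i = v then 1 else 0)"
      by (intro sum.cong) auto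
    also have "\<dots> = of_nat (card ({..<N} \<inter> {j. x j = v}))" by (simp add: sum.If_cases)
    also have "{..<N} \<inter> {j. x j = v} = {j. j < N \<and> x j = v}" by auto
    finally show ?thesis by (simp add: c_def)
  qed
  have prob: "prob_space (q i)" if i: "i < N" for i
  proof
    have "emeasure (q i) (space (q i)) = (\<integral>\<^sup>+ z. 1 \<partial>q i)" by simp
    also have "\<dots> = (\<integral>\<^sup>+ p. w i p \<partial>\<pi>)" by (subst intq) auto
    also have "\<dots> = ennreal (real N / real (c (x i))) * (\<integral>\<^sup>+ p. indicator {x i} (fst p) \<partial>\<pi>)"
      unfolding w_def by (subst nn_integral_cmult) auto
    also have "\<dots> = ennreal (real N / real (c (x i))) * (of_nat (c (x i)) / of_nat N)"
      by (subst fst_int) (auto simp: card)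
    also have "\<dots> = 1" using N c_pos[OF i]
      by (simp add: ennreal_of_nat_eq_real_of_nat divide_ennreal ennreal_mult[symmetric])
    finally show "emeasure (q i) (space (q i)) = 1" .
  qed
  have AE: "AE p in \<pi>. fst p \<in> x ` {..<N}"
  proof -
    have fin: "x ` {..<N} \<in> sets borel" by (intro borel_closed finite_imp_closed) simp
    have "AE z in empirical N x. z \<in> x ` {..<N}"
      unfolding empirical_def using N
      by (subst AE_distr_iff) (auto simp: AE_measure_pmf_iff lessThan_empty_iff fin)
    then show ?thesis unfolding f[symmetric] by (subst (asm) AE_distr_iff) (auto simp: fin)
  qed
  \<comment> \<open>If the first coordinate is the site \<open>v\<close>, exactly \<open>c v\<close>
    indices contribute, each with weight \<open>N / c v\<close>. Averaging over \<open>i\<close>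
    therefore restores \<open>\<pi>\<close>.\<close>
  have one: "AE p in \<pi>. (\<Sum>i<N. w i p) = of_nat N"
    using AE
  proof eventually_elim
    case (elim p)
    then have cp: "c (fst p) > 0" using c_pos by auto
    have "(\<Sum>i<N. w i p) = (\<Sum>i<N. ennreal (real N / real (c (fst p))) * indicator {fst p} (x i))"
      unfolding w_def by (intro sum.cong) (auto simp: indicator_def)
    also have "\<dots> = ennreal (real N / real (c (fst p))) * of_nat (c (fst p))"
      by (simp add: sum_distrib_left[symmetric] card)
    also have "\<dots> = of_nat N" using cp
      by (simp add: ennreal_of_nat_eq_real_of_nat ennreal_mult[symmetric])
    finally show ?case .
  qed
  have main: "(\<Sum>i<N. \<integral>\<^sup>+ z. h (x i) z \<partial>q i) / of_nat N = (\<integral>\<^sup>+ p. h (fst p) (snd p) \<partial>\<pi>)"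
    if h: "case_prod h \<in> borel_measurable (borel \<Otimes>\<^sub>M borel)" for h
  proof -
    note [measurable] = h
    have m: "h (x i) \<in> borel_measurable borel" for i
      using measurable_compose[OF measurable_Pair1'[of "x i" borel borel] h] by simp
    note [measurable] = m
    have "(\<Sum>i<N. \<integral>\<^sup>+ z. h (x i) z \<partial>q i) = (\<Sum>i<N. \<integral>\<^sup>+ p. w i p * h (fst p) (snd p) \<partial>\<pi>)"
    proof (intro sum.cong refl)
      fix i
      show "(\<integral>\<^sup>+ z. h (x i) z \<partial>q i) = (\<integral>\<^sup>+ p. w i p * h (fst p) (snd p) \<partial>\<pi>)"
        unfolding intq[OF m] by (intro nn_integral_cong) (auto simp: w_def indicator_def)
    qed
    also have "\<dots> = (\<integral>\<^sup>+ p. (\<Sum>i<N. w i p * h (fst p) (snd p)) \<partial>\<pi>)"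
      by (subst nn_integral_sum) auto
    also have "\<dots> = (\<integral>\<^sup>+ p. of_nat N * h (fst p) (snd p) \<partial>\<pi>)"
      using one by (intro nn_integral_cong_AE) (auto simp: sum_distrib_right[symmetric])
    also have "\<dots> = of_nat N * (\<integral>\<^sup>+ p. h (fst p) (snd p) \<partial>\<pi>)"
      by (subst nn_integral_cmult) auto
    finally show ?thesis using N
      by (simp add: mult.commute[of "of_nat N"] ennreal_mult_divide_eq)
  qed
  have "is_mixture N q \<nu>"
    unfolding is_mixture_def
  proof (intro conjI allI impI ballI)
    fix g :: "'a \<Rightarrow> ennreal" assume g[measurable]: "g \<in> borel_measurable borel"
    have "(\<integral>\<^sup>+ z. g z \<partial>\<nu>) = (\<integral>\<^sup>+ p. g (snd p) \<partial>\<pi>)"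
      unfolding sn[symmetric] by (subst nn_integral_distr) auto
    then show "(\<integral>\<^sup>+ z. g z \<partial>\<nu>) = (\<Sum>i<N. \<integral>\<^sup>+ z. g z \<partial>q i) / of_nat N"
      using main[of "\<lambda>_. g"] by simp
  qed (rule prob, simp_all add: q_def sn[symmetric])
  moreover have "(\<Sum>i<N. \<integral>\<^sup>+ z. ennreal (dist (x i) z) \<partial>q i) / of_nat N
      = (\<integral>\<^sup>+ p. ennreal (dist (fst p) (snd p)) \<partial>\<pi>)"
    by (rule main) simp
  ultimately show ?thesis by blast
qed

lemma W1_empirical_approx:
  fixes \<nu> :: "'a::euclidean_space measure"
  assumes N: "N > 0" and less: "W1 (empirical N x) \<nu> < r"
  obtains q where "is_mixture N q \<nu>"
    "(\<Sum>i<N. \<integral>\<^sup>+ z. ennreal (dist (x i) z) \<partial>q i) / of_nat N < r"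
proof -
  from less obtain \<pi> where "\<pi> \<in> couplings (empirical N x) \<nu>"
    "(\<integral>\<^sup>+ p. ennreal (dist (fst p) (snd p)) \<partial>\<pi>) < r"
    unfolding W1_def INF_less_iff by blast
  with couplings_empirical_mixture[OF N this(1)] that show ?thesis by auto
qed

text \<open>The family \<open>q\<close> is kept while the base points move from \<open>x\<close> to
  \<open>y\<close>, so the pointwise triangle inequality suffices and no couplings have to be glued.
  The added term is the cost of matching equal indices, which makes this a continuity estimate in
  the configuration as well.\<close>

lemma W1_empirical_triangle:
  fixes \<nu> :: "'a::euclidean_space measure"
  assumes N: "N > 0"
  shows "W1 (empirical N y) \<nu> \<le> ennreal ((\<Sum>i<N. dist (y i) (x i)) / real N) + W1 (empirical N x) \<nu>"
proof (rule ennreal_le_epsilon)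
  fix e :: real assume e: "e > 0" and fin: "ennreal ((\<Sum>i<N. dist (y i) (x i)) / real N) + W1 (empirical N x) \<nu> < top"
  \<comment> \<open>The infimum need not be attained, hence the slack \<open>e\<close>; the
    inequality is strict because \<open>fin\<close> makes the distance finite.\<close>
  then have "W1 (empirical N x) \<nu> < W1 (empirical N x) \<nu> + ennreal e"
    by (cases "W1 (empirical N x) \<nu>") (auto simp: ennreal_less_iff simp flip: ennreal_plus)
  from W1_empirical_approx[OF N this] obtain q where q: "is_mixture N q \<nu>"
    and le: "(\<Sum>i<N. \<integral>\<^sup>+ z. ennreal (dist (x i) z) \<partial>q i) / of_nat N < W1 (empirical N x) \<nu> + ennreal e" .
  note qD = is_mixtureD[OF q]
  have "W1 (empirical N y) \<nu> \<le> (\<Sum>i<N. \<integral>\<^sup>+ z. ennreal (dist (y i) z) \<partial>q i) / of_nat N"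
    by (rule W1_empirical_le[OF N q])
  also have "\<dots> \<le> (\<Sum>i<N. ennreal (dist (y i) (x i)) + (\<integral>\<^sup>+ z. ennreal (dist (x i) z) \<partial>q i)) / of_nat N"
  proof (intro divide_right_mono_ennreal sum_mono)
    fix i assume i: "i \<in> {..<N}"
    then have [measurable_cong]: "sets (q i) = sets borel" using qD by auto
    have "(\<integral>\<^sup>+ z. ennreal (dist (y i) z) \<partial>q i) \<le> (\<integral>\<^sup>+ z. ennreal (dist (y i) (x i)) + ennreal (dist (x i) z) \<partial>q i)"
      by (intro nn_integral_mono) (auto simp: dist_triangle simp flip: ennreal_plus)
    also have "\<dots> = ennreal (dist (y i) (x i)) + (\<integral>\<^sup>+ z. ennreal (dist (x i) z) \<partial>q i)"
      using qD(1)[of i] i by (subst nn_integral_add) (auto simp: prob_space.emeasure_space_1)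
    finally show "(\<integral>\<^sup>+ z. ennreal (dist (y i) z) \<partial>q i) \<le> \<dots>" .
  qed
  also have "\<dots> = ennreal ((\<Sum>i<N. dist (y i) (x i)) / real N) + (\<Sum>i<N. \<integral>\<^sup>+ z. ennreal (dist (x i) z) \<partial>q i) / of_nat N"
    using N by (simp add: sum.distrib sum_ennreal_divide_of_nat[symmetric] divide_ennreal_def distrib_right)
  also have "\<dots> \<le> ennreal ((\<Sum>i<N. dist (y i) (x i)) / real N) + (W1 (empirical N x) \<nu> + ennreal e)"
    using le by (intro add_left_mono) auto
  finally show "W1 (empirical N y) \<nu> \<le> ennreal ((\<Sum>i<N. dist (y i) (x i)) / real N) + W1 (empirical N x) \<nu> + ennreal e"
    by (simp add: add.assoc)
qed

lemma empirical_cong: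
  assumes "N > 0" "\<And>i. i < N \<Longrightarrow> x i = y i"
  shows "empirical N x = empirical N y"
  by (rule measure_eqI_nn_integral) (auto simp: nn_integral_empirical assms)

text \<open>By the triangle estimate the distance is upper semicontinuous in the configuration:
  around each point of a strict sublevel set, \<open>?s y < a\<close> cuts out an open subset of
  it.\<close>

lemma borel_measurable_W1_empirical:
  fixes \<nu> :: "'a::euclidean_space measure"
  assumes N: "N > 0" and Y: "\<And>i. i < N \<Longrightarrow> Y i \<in> borel_measurable M"
  shows "(\<lambda>\<omega>. W1 (empirical N (\<lambda>i. Y i \<omega>)) \<nu>) \<in> borel_measurable M"
proof -
  have op: "open {x. W1 (empirical N x) \<nu> < a}" for a
  proof (subst open_subopen, intro ballI)
    fix x assume "x \<in> {x. W1 (empirical N x) \<nu> < a}"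
    then have x: "W1 (empirical N x) \<nu> < a" by simp
    let ?s = "\<lambda>y. ennreal ((\<Sum>i<N. dist (y i) (x i)) / real N) + W1 (empirical N x) \<nu>"
    have c: "continuous_on UNIV (\<lambda>y::nat\<Rightarrow>'a. (\<Sum>i<N. dist (y i) (x i)) / real N)"
      using N by (intro continuous_intros continuous_on_product_coordinates) auto
    have "open {y. ?s y < a}"
      by (intro open_Collect_less continuous_on_add_ennreal continuous_on_ennreal c continuous_intros)
    moreover have "x \<in> {y. ?s y < a}" using x by simp
    moreover have "{y. ?s y < a} \<subseteq> {x. W1 (empirical N x) \<nu> < a}"
      using W1_empirical_triangle[OF N] by (auto intro: le_less_trans)
    ultimately show "\<exists>T. open T \<and> x \<in> T \<and> T \<subseteq> {x. W1 (empirical N x) \<nu> < a}" by blast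
  qed
  have W: "(\<lambda>x::nat\<Rightarrow>'a. W1 (empirical N x) \<nu>) \<in> borel_measurable borel"
    by (rule borel_measurableI_less) (use op in auto)
  \<comment> \<open>Coordinates from \<open>N\<close> on are frozen at 0, since \<open>Y i\<close>
    is assumed measurable only for \<open>i < N\<close>. On the countable product, the product
    sigma-algebra is the Borel one, so openness can be used.\<close>
  have "(\<lambda>\<omega> i. if i < N then Y i \<omega> else 0) \<in> M \<rightarrow>\<^sub>M PiM UNIV (\<lambda>_. borel)"
  proof (rule measurable_PiM_single')
    show "(\<lambda>\<omega>. if i < N then Y i \<omega> else 0) \<in> borel_measurable M" for i
      using Y by (cases "i < N") auto
  qed auto
  then have "(\<lambda>\<omega> i. if i < N then Y i \<omega> else 0) \<in> M \<rightarrow>\<^sub>M borel"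
    by (simp add: measurable_cong_sets[OF refl sets_PiM_equal_borel])
  from measurable_compose[OF this W]
  have "(\<lambda>\<omega>. W1 (empirical N (\<lambda>i. if i < N then Y i \<omega> else 0)) \<nu>) \<in> borel_measurable M" .
  also have "(\<lambda>\<omega>. W1 (empirical N (\<lambda>i. if i < N then Y i \<omega> else 0)) \<nu>)
    = (\<lambda>\<omega>. W1 (empirical N (\<lambda>i. Y i \<omega>)) \<nu>)"
    by (intro ext arg_cong2[where f=W1] empirical_cong N refl) auto
  finally show ?thesis .
qed

section \<open>Couplings adapted to a finite partition\<close>

text \<open>Only the cell masses are matched; given their cells, the two points are independent. The
  chance of landing in different cells is thus governed by finitely many masses, which a law of
  large numbers controls. The total variation distance of the measures themselves would be useless,
  as an empirical measure may be singular to its limit.\<close>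

lemma cell_coupling:
  fixes \<mu> \<nu> :: "'a::euclidean_space measure" and c :: "'a \<Rightarrow> 'b"
  assumes \<mu>: "prob_space \<mu>" "sets \<mu> = sets borel" and \<nu>: "prob_space \<nu>" "sets \<nu> = sets borel"
    and J: "finite J" "\<And>y. c y \<in> J" and c: "\<And>j. j \<in> J \<Longrightarrow> c -` {j} \<in> sets borel"
  shows "\<exists>\<pi>\<in>couplings \<mu> \<nu>. emeasure \<pi> {u. c (fst u) \<noteq> c (snd u)}
    \<le> ennreal (\<Sum>j\<in>J. \<bar>measure \<mu> (c -` {j}) - measure \<nu> (c -` {j})\<bar>)"
proof -
  interpret \<mu>: prob_space \<mu> by fact
  interpret \<nu>: prob_space \<nu> by fact
  interpret pair_sigma_finite \<mu> \<nu> ..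
  note [measurable_cong] = \<mu>(2) \<nu>(2)
  have sp: "space \<mu> = UNIV" "space \<nu> = UNIV"
    using \<mu>(2) \<nu>(2) by (auto dest: sets_eq_imp_space_eq)
  define C where "C j = (if j \<in> J then c -` {j} else {})" for j
  have C[measurable]: "C j \<in> sets borel" for j using c by (simp add: C_def)
  have indC: "indicator (C j) y = (if c y = j then 1 else 0 :: ennreal)" if "j \<in> J" for j y
    using that by (auto simp: C_def indicator_def)
  define p where "p j = measure \<mu> (C j)" for j
  define q where "q j = measure \<nu> (C j)" for j
  have p0: "p j \<ge> 0" and q0: "q j \<ge> 0" for j by (auto simp: p_def q_def)
  have p_int: "(\<integral>\<^sup>+ y. indicator (C j) y \<partial>\<mu>) = ennreal (p j)" for j
    by (simp add: p_def \<mu>.emeasure_eq_measure)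
  have q_int: "(\<integral>\<^sup>+ y. indicator (C j) y \<partial>\<nu>) = ennreal (q j)" for j
    by (simp add: q_def \<nu>.emeasure_eq_measure)
  have UN: "(\<Union>j\<in>J. C j) = UNIV" using J(2) by (auto simp: C_def)
  have disj: "disjoint_family_on C J" by (auto simp: C_def disjoint_family_on_def)
  have p1: "(\<Sum>j\<in>J. p j) = 1"
  proof -
    have "C ` J \<subseteq> sets \<mu>" unfolding \<mu>(2) by (intro image_subsetI C)
    from \<mu>.finite_measure_finite_Union[OF J(1) this disj]
    have "(\<Sum>j\<in>J. measure \<mu> (C j)) = measure \<mu> (\<Union>j\<in>J. C j)" ..
    also have "\<dots> = 1" unfolding UN sp(1)[symmetric] by (rule \<mu>.prob_space)
    finally show ?thesis unfolding p_def .
  qed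
  have q1: "(\<Sum>j\<in>J. q j) = 1"
  proof -
    have "C ` J \<subseteq> sets \<nu>" unfolding \<nu>(2) by (intro image_subsetI C)
    from \<nu>.finite_measure_finite_Union[OF J(1) this disj]
    have "(\<Sum>j\<in>J. measure \<nu> (C j)) = measure \<nu> (\<Union>j\<in>J. C j)" ..
    also have "\<dots> = 1" unfolding UN sp(2)[symmetric] by (rule \<nu>.prob_space)
    finally show ?thesis unfolding q_def .
  qed
  \<comment> \<open>\<open>a\<close> and \<open>b\<close> are the surpluses left on either side
    after the common mass of each cell is matched; both have total \<open>t\<close>.\<close>
  define a where "a j = p j - min (p j) (q j)" for j
  define b where "b j = q j - min (p j) (q j)" for j
  define t where "t = (\<Sum>j\<in>J. a j)"
  have a0: "a j \<ge> 0" and b0: "b j \<ge> 0" for j by (auto simp: a_def b_def)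
  have tb: "t = (\<Sum>j\<in>J. b j)"
    by (simp add: t_def a_def b_def sum_subtractf p1 q1)
  have t0: "t \<ge> 0" by (simp add: t_def a0 sum_nonneg)
  \<comment> \<open>If \<open>t = 0\<close>, all surpluses vanish, so with division by zero equal to
    0 the degenerate case needs no separate treatment.\<close>
  have at: "a j * t / t = a j" if "j \<in> J" for j
    using that a0 J(1) by (cases "t = 0") (auto simp: t_def sum_nonneg_eq_0_iff)
  have bt: "b j * t / t = b j" if "j \<in> J" for j
    using that b0 J(1) by (cases "t = 0") (auto simp: tb sum_nonneg_eq_0_iff)
  \<comment> \<open>\<open>\<gamma>\<close> is the maximal coupling of the cell masses; the coupling of \<open>\<mu>\<close> and \<open>\<nu>\<close> is the
    multiple of \<open>\<mu> \<Otimes> \<nu>\<close> on each product of cells that has mass \<open>\<gamma> i j\<close>\<close>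
  define \<gamma> where "\<gamma> i j = (if i = j then min (p i) (q i) else 0) + a i * b j / t" for i j
  have \<gamma>0: "\<gamma> i j \<ge> 0" for i j unfolding \<gamma>_def using a0 b0 p0 q0 t0 by auto
  have row: "(\<Sum>j\<in>J. \<gamma> i j) = p i" if "i \<in> J" for i
  proof -
    have "(\<Sum>j\<in>J. \<gamma> i j) = min (p i) (q i) + a i * t / t"
      using that J(1) by (simp add: \<gamma>_def sum.distrib tb sum_distrib_left sum_divide_distrib)
    then show ?thesis using at[OF that] by (simp add: a_def)
  qed
  have col: "(\<Sum>i\<in>J. \<gamma> i j) = q j" if "j \<in> J" for j
  proof -
    have "(\<Sum>i\<in>J. \<gamma> i j) = min (p j) (q j) + t * b j / t"
      using that J(1) by (simp add: \<gamma>_def sum.distrib t_def sum_distrib_right sum_divide_distrib)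
    then show ?thesis using bt[OF that] by (simp add: b_def mult.commute)
  qed
  have \<gamma>p: "\<gamma> i j = 0" if "p i = 0" for i j
    using that q0[of i] by (auto simp: \<gamma>_def a_def)
  have \<gamma>q: "\<gamma> i j = 0" if "q j = 0" for i j
    using that p0[of j] by (auto simp: \<gamma>_def b_def)
  \<comment> \<open>\<open>g\<close> is the density with respect to the product measure. Where a
    cell mass in the denominator is zero, \<open>\<gamma>\<close> vanishes too, so no mass is lost
    there; the marginals are then computed off the null cells.\<close>
  define g where "g i j = \<gamma> i j / (p i * q j)" for i j
  have g0: "g i j \<ge> 0" for i j using \<gamma>0 p0 q0 by (simp add: g_def)
  define k where "k u = (\<Sum>i\<in>J. \<Sum>j\<in>J. ennreal (g i j) * (indicator (C i) (fst u) * indicator (C j) (snd u)))"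
    for u :: "'a \<times> 'a"
  have k[measurable]: "k \<in> borel_measurable (\<mu> \<Otimes>\<^sub>M \<nu>)"
    unfolding k_def by measurable
  define \<pi> where "\<pi> = density (\<mu> \<Otimes>\<^sub>M \<nu>) k"
  have int: "(\<integral>\<^sup>+ u. h u \<partial>\<pi>) = (\<integral>\<^sup>+ u. k u * h u \<partial>(\<mu> \<Otimes>\<^sub>M \<nu>))"
    if [measurable]: "h \<in> borel_measurable (\<mu> \<Otimes>\<^sub>M \<nu>)" for h
    unfolding \<pi>_def by (subst nn_integral_density) auto
  have AEp: "AE y in \<mu>. p (c y) \<noteq> 0"
  proof -
    have "AE y in \<mu>. \<forall>j\<in>J. p j = 0 \<longrightarrow> y \<notin> C j"
      using J(1)
    proof (subst AE_ball_countable[OF countable_finite], assumption, intro ballI)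
      fix j
      show "AE y in \<mu>. p j = 0 \<longrightarrow> y \<notin> C j"
      proof (cases "p j = 0")
        case True
        then have "emeasure \<mu> (C j) = 0" by (simp add: p_def \<mu>.emeasure_eq_measure)
        then show ?thesis by (intro AE_I[where N="C j"]) auto
      qed auto
    qed
    then show ?thesis
    proof eventually_elim
      case (elim y)
      then show ?case using J(2)[of y] by (auto simp: C_def)
    qed
  qed
  have AEq: "AE y in \<nu>. q (c y) \<noteq> 0"
  proof -
    have "AE y in \<nu>. \<forall>j\<in>J. q j = 0 \<longrightarrow> y \<notin> C j"
      using J(1)
    proof (subst AE_ball_countable[OF countable_finite], assumption, intro ballI)
      fix j
      show "AE y in \<nu>. q j = 0 \<longrightarrow> y \<notin> C j"
      proof (cases "q j = 0")
        case True
        then have "emeasure \<nu> (C j) = 0" by (simp add: q_def \<nu>.emeasure_eq_measure)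
        then show ?thesis by (intro AE_I[where N="C j"]) auto
      qed auto
    qed
    then show ?thesis
    proof eventually_elim
      case (elim y)
      then show ?case using J(2)[of y] by (auto simp: C_def)
    qed
  qed
  have gq: "g i j * q j = \<gamma> i j / p i" for i j using \<gamma>q by (auto simp: g_def)
  have gp: "g i j * p i = \<gamma> i j / q j" for i j using \<gamma>p by (auto simp: g_def)
  have marg1: "(\<integral>\<^sup>+ z. k (y, z) \<partial>\<nu>) = 1" if y: "p (c y) \<noteq> 0" for y
  proof -
    have "k (y, z) = (\<Sum>j\<in>J. ennreal (g (c y) j) * indicator (C j) z)" for z
    proof -
      have "k (y, z) = (\<Sum>i\<in>J. if c y = i then (\<Sum>j\<in>J. ennreal (g i j) * indicator (C j) z) else 0)"
        unfolding k_def by (intro sum.cong refl) (simp add: indC)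
      then show ?thesis using J by simp
    qed
    then have "(\<integral>\<^sup>+ z. k (y, z) \<partial>\<nu>) = (\<Sum>j\<in>J. \<integral>\<^sup>+ z. ennreal (g (c y) j) * indicator (C j) z \<partial>\<nu>)"
      by (simp add: nn_integral_sum)
    also have "\<dots> = (\<Sum>j\<in>J. ennreal (g (c y) j * q j))"
      by (intro sum.cong refl, subst nn_integral_cmult) (auto simp: q_int ennreal_mult g0 q0)
    also have "\<dots> = ennreal (\<Sum>j\<in>J. \<gamma> (c y) j / p (c y))"
      unfolding gq by (subst sum_ennreal) (auto simp: \<gamma>0 p0)
    also have "\<dots> = 1" using y row[OF J(2)[of y]] by (simp add: sum_divide_distrib[symmetric])
    finally show ?thesis .
  qed
  have marg2: "(\<integral>\<^sup>+ y. k (y, z) \<partial>\<mu>) = 1" if z: "q (c z) \<noteq> 0" for z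
  proof -
    have "k (y, z) = (\<Sum>i\<in>J. ennreal (g i (c z)) * indicator (C i) y)" for y
    proof -
      have "k (y, z) = (\<Sum>i\<in>J. \<Sum>j\<in>J. if c z = j then ennreal (g i j) * indicator (C i) y else 0)"
        unfolding k_def by (intro sum.cong refl) (simp add: indC)
      then show ?thesis using J by simp
    qed
    then have "(\<integral>\<^sup>+ y. k (y, z) \<partial>\<mu>) = (\<Sum>i\<in>J. \<integral>\<^sup>+ y. ennreal (g i (c z)) * indicator (C i) y \<partial>\<mu>)"
      by (simp add: nn_integral_sum)
    also have "\<dots> = (\<Sum>i\<in>J. ennreal (g i (c z) * p i))"
      by (intro sum.cong refl, subst nn_integral_cmult) (auto simp: p_int ennreal_mult g0 p0)
    also have "\<dots> = ennreal (\<Sum>i\<in>J. \<gamma> i (c z) / q (c z))"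
      unfolding gp by (subst sum_ennreal) (auto simp: \<gamma>0 q0)
    also have "\<dots> = 1" using z col[OF J(2)[of z]] by (simp add: sum_divide_distrib[symmetric])
    finally show ?thesis .
  qed
  have s\<pi>: "sets \<pi> = sets (borel \<Otimes>\<^sub>M borel)"
    unfolding \<pi>_def using sets_pair_measure_cong[OF \<mu>(2) \<nu>(2)] by simp
  note [measurable_cong] = s\<pi>
  have fst: "distr \<pi> borel fst = \<mu>"
  proof (rule measure_eqI_nn_integral)
    fix h :: "'a \<Rightarrow> ennreal" assume "h \<in> borel_measurable (distr \<pi> borel fst)"
    then have [measurable]: "h \<in> borel_measurable borel" by simp
    have "(\<integral>\<^sup>+ x. h x \<partial>distr \<pi> borel fst) = (\<integral>\<^sup>+ u. k u * h (fst u) \<partial>(\<mu> \<Otimes>\<^sub>M \<nu>))"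
      by (subst nn_integral_distr) (auto simp: int)
    also have "\<dots> = (\<integral>\<^sup>+ y. \<integral>\<^sup>+ z. k (y, z) * h y \<partial>\<nu> \<partial>\<mu>)"
      by (subst \<nu>.nn_integral_fst[symmetric]) auto
    also have "\<dots> = (\<integral>\<^sup>+ y. (\<integral>\<^sup>+ z. k (y, z) \<partial>\<nu>) * h y \<partial>\<mu>)"
      by (intro nn_integral_cong nn_integral_multc) measurable
    also have "\<dots> = (\<integral>\<^sup>+ y. h y \<partial>\<mu>)"
      using AEp by (intro nn_integral_cong_AE) (auto simp: marg1)
    finally show "(\<integral>\<^sup>+ x. h x \<partial>distr \<pi> borel fst) = (\<integral>\<^sup>+ y. h y \<partial>\<mu>)" .
  qed (simp add: \<mu>)
  have snd: "distr \<pi> borel snd = \<nu>"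
  proof (rule measure_eqI_nn_integral)
    fix h :: "'a \<Rightarrow> ennreal" assume "h \<in> borel_measurable (distr \<pi> borel snd)"
    then have [measurable]: "h \<in> borel_measurable borel" by simp
    have "(\<integral>\<^sup>+ x. h x \<partial>distr \<pi> borel snd) = (\<integral>\<^sup>+ u. k u * h (snd u) \<partial>(\<mu> \<Otimes>\<^sub>M \<nu>))"
      by (subst nn_integral_distr) (auto simp: int)
    also have "\<dots> = (\<integral>\<^sup>+ z. \<integral>\<^sup>+ y. k (y, z) * h z \<partial>\<mu> \<partial>\<nu>)"
      by (subst nn_integral_snd[symmetric]) auto
    also have "\<dots> = (\<integral>\<^sup>+ z. (\<integral>\<^sup>+ y. k (y, z) \<partial>\<mu>) * h z \<partial>\<nu>)"
      by (intro nn_integral_cong nn_integral_multc) measurable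
    also have "\<dots> = (\<integral>\<^sup>+ y. h y \<partial>\<nu>)"
      using AEq by (intro nn_integral_cong_AE) (auto simp: marg2)
    finally show "(\<integral>\<^sup>+ x. h x \<partial>distr \<pi> borel snd) = (\<integral>\<^sup>+ y. h y \<partial>\<nu>)" .
  qed (simp add: \<nu>)
  have "prob_space \<pi>"
    by (rule prob_space_distrD[of fst \<pi> borel]) (auto simp: fst \<mu>)
  then have coup: "\<pi> \<in> couplings \<mu> \<nu>" using s\<pi> fst snd by (simp add: couplings_def)
  define D where "D = (\<Union>i\<in>J. \<Union>j\<in>J-{i}. C i \<times> C j)"
  have D: "{u. c (fst u) \<noteq> c (snd u)} = D"
    using J(2) by (auto simp: D_def C_def split: if_splits)
  have [measurable]: "D \<in> sets (borel \<Otimes>\<^sub>M borel)"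
    unfolding D_def using J(1) by (intro sets.finite_UN) auto
  \<comment> \<open>\<open>l\<close> comes from the surplus part of \<open>\<gamma>\<close> alone.
    On pairs in different cells the diagonal part does not contribute, so \<open>l\<close> bounds
    the density there, and its integral is the surplus \<open>t\<close>.\<close>
  define l where "l i j = a i * b j / t / (p i * q j)" for i j
  have l0: "l i j \<ge> 0" for i j unfolding l_def using a0 b0 p0 q0 t0 by simp
  have lpq: "l i j * (p i * q j) = a i * b j / t" for i j
    using p0[of j] q0[of i] by (cases "p i = 0 \<or> q j = 0") (auto simp: l_def a_def b_def)
  have "emeasure \<pi> D = (\<integral>\<^sup>+ u. k u * indicator D u \<partial>(\<mu> \<Otimes>\<^sub>M \<nu>))"
    unfolding \<pi>_def by (subst emeasure_density) auto
  also have "\<dots> \<le> (\<integral>\<^sup>+ u. (\<Sum>i\<in>J. \<Sum>j\<in>J. ennreal (l i j) * (indicator (C i) (fst u) * indicator (C j) (snd u))) \<partial>(\<mu> \<Otimes>\<^sub>M \<nu>))"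
  proof (intro nn_integral_mono)
    fix u :: "'a \<times> 'a"
    show "k u * indicator D u \<le> (\<Sum>i\<in>J. \<Sum>j\<in>J. ennreal (l i j) * (indicator (C i) (fst u) * indicator (C j) (snd u)))"
    proof (cases "c (fst u) = c (snd u)")
      case True then show ?thesis using D by (auto simp: indicator_def)
    next
      case False
      have "k u \<le> (\<Sum>i\<in>J. \<Sum>j\<in>J. ennreal (l i j) * (indicator (C i) (fst u) * indicator (C j) (snd u)))"
        unfolding k_def
        using False by (intro sum_mono) (auto simp: indC g_def l_def \<gamma>_def)
      then show ?thesis by (auto simp: indicator_def)
    qed
  qed
  also have "\<dots> = (\<Sum>i\<in>J. \<Sum>j\<in>J. ennreal (l i j) * (\<integral>\<^sup>+ u. (indicator (C i) (fst u) * indicator (C j) (snd u)) \<partial>(\<mu> \<Otimes>\<^sub>M \<nu>)))"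
    by (simp add: nn_integral_sum nn_integral_cmult)
  also have "\<dots> = (\<Sum>i\<in>J. \<Sum>j\<in>J. ennreal (a i * b j / t))"
  proof (intro sum.cong refl)
    fix i j
    have "(\<integral>\<^sup>+ u. (indicator (C i) (fst u) * indicator (C j) (snd u)) \<partial>(\<mu> \<Otimes>\<^sub>M \<nu>))
      = (\<integral>\<^sup>+ y. indicator (C i) y * ennreal (q j) \<partial>\<mu>)"
      by (subst \<nu>.nn_integral_fst[symmetric]) (auto simp: nn_integral_cmult q_int)
    also have "\<dots> = ennreal (p i * q j)"
      by (simp add: nn_integral_multc p_int ennreal_mult p0 q0)
    finally show "ennreal (l i j) * (\<integral>\<^sup>+ u. (indicator (C i) (fst u) * indicator (C j) (snd u)) \<partial>(\<mu> \<Otimes>\<^sub>M \<nu>))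
      = ennreal (a i * b j / t)"
      using lpq[of i j] by (simp add: ennreal_mult[symmetric] l0 p0 q0)
  qed
  also have "\<dots> = ennreal (\<Sum>i\<in>J. \<Sum>j\<in>J. a i * b j / t)"
    using a0 b0 t0 by (simp add: sum_ennreal sum_nonneg)
  also have "(\<Sum>i\<in>J. \<Sum>j\<in>J. a i * b j / t) = (\<Sum>i\<in>J. a i)"
    using at by (simp add: sum_distrib_left[symmetric] sum_divide_distrib[symmetric] tb[symmetric])
  also have "ennreal (\<Sum>i\<in>J. a i) \<le> ennreal (\<Sum>j\<in>J. \<bar>measure \<mu> (c -` {j}) - measure \<nu> (c -` {j})\<bar>)"
    by (intro ennreal_leI sum_mono) (auto simp: a_def p_def q_def C_def)
  finally show ?thesis using coup D by (intro bexI[of _ \<pi>]) auto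
qed

text \<open>Under the cell coupling, a pair in one cell with a point in the ball of radius
  \<open>R\<close> is within \<open>\<eta>\<close>. For two points outside the ball the distance is
  paid by the two tails. In the remaining pairs the cells differ, and a point inside the ball
  contributes at most \<open>R\<close>, a point outside its own tail.\<close>

lemma W1_cells_le:
  fixes \<mu> \<nu> :: "'a::euclidean_space measure" and c :: "'a \<Rightarrow> 'b"
  assumes \<mu>: "prob_space \<mu>" "sets \<mu> = sets borel" and \<nu>: "prob_space \<nu>" "sets \<nu> = sets borel"
    and J: "finite J" "\<And>y. c y \<in> J" and c: "\<And>j. j \<in> J \<Longrightarrow> c -` {j} \<in> sets borel"
    and diam: "\<And>y z. c y = c z \<Longrightarrow> norm y \<le> R \<Longrightarrow> dist y z \<le> \<eta>" and pos: "\<eta> \<ge> 0" "R \<ge> 0"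
  defines "T \<equiv> \<lambda>y. ennreal (norm y) * indicator {y. R < norm y} y"
  shows "W1 \<mu> \<nu> \<le> ennreal \<eta> + (\<integral>\<^sup>+ y. T y \<partial>\<mu>) + (\<integral>\<^sup>+ y. T y \<partial>\<nu>)
    + ennreal (2 * R * (\<Sum>j\<in>J. \<bar>measure \<mu> (c -` {j}) - measure \<nu> (c -` {j})\<bar>))"
proof -
  let ?S = "\<Sum>j\<in>J. \<bar>measure \<mu> (c -` {j}) - measure \<nu> (c -` {j})\<bar>"
  let ?D = "{u. c (fst u) \<noteq> c (snd u)}"
  obtain \<pi> where \<pi>: "\<pi> \<in> couplings \<mu> \<nu>" and le: "emeasure \<pi> ?D \<le> ennreal ?S"
    using cell_coupling[OF \<mu> \<nu> J c] by blast
  from \<pi> have s[measurable_cong]: "sets \<pi> = sets (borel \<Otimes>\<^sub>M borel)" and pr: "prob_space \<pi>"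
    and f: "distr \<pi> borel fst = \<mu>" and sn: "distr \<pi> borel snd = \<nu>" by (auto simp: couplings_def)
  interpret prob_space \<pi> by fact
  have T[measurable]: "T \<in> borel_measurable borel" unfolding T_def by measurable
  have "?D = (\<Union>i\<in>J. \<Union>j\<in>J-{i}. (c -` {i}) \<times> (c -` {j}))" using J(2) by auto
  moreover have "\<dots> \<in> sets (borel \<Otimes>\<^sub>M borel)"
    using J(1) c by (intro sets.finite_UN) auto
  ultimately have [measurable]: "?D \<in> sets (borel \<Otimes>\<^sub>M borel)" by simp
  have "W1 \<mu> \<nu> \<le> (\<integral>\<^sup>+ u. ennreal (dist (fst u) (snd u)) \<partial>\<pi>)"
    unfolding W1_def using \<pi> by (rule INF_lower)
  also have "\<dots> \<le> (\<integral>\<^sup>+ u. ennreal \<eta> + T (fst u) + T (snd u) + ennreal (2 * R) * indicator ?D u \<partial>\<pi>)"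
  proof (rule nn_integral_mono)
    fix u :: "'a \<times> 'a"
    obtain y z where u: "u = (y, z)" by (cases u)
    have tri: "dist y z \<le> norm y + norm z" by (metis dist_0_norm dist_commute dist_triangle)
    define ty where "ty = (if R < norm y then norm y else 0)"
    define tz where "tz = (if R < norm z then norm z else 0)"
    define d where "d = (if c y \<noteq> c z then 2 * R else 0)"
    have "dist y z \<le> \<eta> + ty + tz + d"
      using tri diam[of y z] diam[of z y] pos norm_ge_zero[of y] norm_ge_zero[of z]
      unfolding ty_def tz_def d_def by (auto simp: dist_commute)
    then have "ennreal (dist y z) \<le> ennreal (\<eta> + ty + tz + d)" by (rule ennreal_leI)
    also have "\<dots> = ennreal \<eta> + ennreal ty + ennreal tz + ennreal d"
      using pos by (simp add: ty_def tz_def d_def)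
    also have "\<dots> = ennreal \<eta> + T (fst u) + T (snd u) + ennreal (2 * R) * indicator ?D u"
      by (simp add: ty_def tz_def d_def u T_def)
    finally show "ennreal (dist (fst u) (snd u)) \<le> \<dots>" using u by simp
  qed
  also have "\<dots> = ennreal \<eta> + (\<integral>\<^sup>+ u. T (fst u) \<partial>\<pi>) + (\<integral>\<^sup>+ u. T (snd u) \<partial>\<pi>) + ennreal (2 * R) * emeasure \<pi> ?D"
    by (simp add: nn_integral_add nn_integral_cmult emeasure_space_1)
  also have "(\<integral>\<^sup>+ u. T (fst u) \<partial>\<pi>) = (\<integral>\<^sup>+ y. T y \<partial>\<mu>)"
    unfolding f[symmetric] by (subst nn_integral_distr) auto
  also have "(\<integral>\<^sup>+ u. T (snd u) \<partial>\<pi>) = (\<integral>\<^sup>+ y. T y \<partial>\<nu>)"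
    unfolding sn[symmetric] by (subst nn_integral_distr) auto
  also have "ennreal (2 * R) * emeasure \<pi> ?D \<le> ennreal (2 * R) * ennreal ?S"
    by (intro mult_left_mono le) auto
  also have "\<dots> = ennreal (2 * R * ?S)"
    using pos by (simp add: ennreal_mult sum_nonneg)
  finally show ?thesis by (simp add: add_left_mono)
qed

text \<open>The label of a point of the ball is the set of all net centres closer than
  \<open>\<eta> / 2\<close>, so two points with the same nonempty label share a centre. Points
  outside the ball get the empty label, which the covering property denies to points inside. Labels
  range over the finite set \<open>Pow S\<close>.\<close>

lemma ex_cells:
  fixes \<eta> R :: real
  assumes "\<eta> > 0"
  obtains c :: "'a::euclidean_space \<Rightarrow> 'a set" and J where "finite J" "\<And>y. c y \<in> J"
    "\<And>j. j \<in> J \<Longrightarrow> c -` {j} \<in> sets borel" "\<And>y z. c y = c z \<Longrightarrow> norm y \<le> R \<Longrightarrow> dist y z \<le> \<eta>"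
proof -
  have "compact (cball (0::'a) R)" by simp
  then obtain S :: "'a set" where S: "finite S" "cball 0 R \<subseteq> (\<Union>s\<in>S. ball s (\<eta> / 2))"
    using assms unfolding compact_eq_totally_bounded by (meson half_gt_zero)
  define c where "c y = {s \<in> S. dist s y < \<eta> / 2 \<and> norm y \<le> R}" for y
  show thesis
  proof
    show "finite (Pow S)" using S by simp
    show "c y \<in> Pow S" for y by (auto simp: c_def)
    show "c -` {j} \<in> sets borel" if "j \<in> Pow S" for j
    proof -
      have "c -` {j} = {y \<in> space borel. \<forall>s\<in>S. (dist s y < \<eta> / 2 \<and> norm y \<le> R) = (s \<in> j)}"
        using that by (auto simp: c_def set_eq_iff)
      also have "\<dots> \<in> sets borel" using S(1) by measurable
      finally show ?thesis .
    qed
    show "dist y z \<le> \<eta>" if "c y = c z" "norm y \<le> R" for y z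
    proof -
      from that(2) have "y \<in> cball 0 R" by simp
      with S(2) obtain s where "s \<in> S" "dist s y < \<eta> / 2" by auto
      with that have "s \<in> c y" "s \<in> c z" by (auto simp: c_def)
      then have "dist s y < \<eta> / 2" "dist s z < \<eta> / 2" by (auto simp: c_def)
      then have "dist y z < \<eta>" by (rule dist_triangle_half_r)
      then show ?thesis by simp
    qed
  qed
qed

section \<open>A uniform law of large numbers in Wasserstein distance\<close>

text \<open>The centred indicators are bounded by 1 and uncorrelated, so their sum has second moment
  at most \<open>N\<close> whatever the individual laws are. This is the source of the uniformity in
  the law of large numbers.\<close>

lemma (in prob_space) expectation_abs_frequency_deviation:
  assumes ind: "indep_vars (\<lambda>_. borel) W {..<N}" and N: "N > 0" and B[measurable]: "B \<in> sets borel"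
  defines "p \<equiv> \<lambda>i. expectation (\<lambda>\<omega>. indicator B (W i \<omega>))"
  shows "(\<integral>\<^sup>+ \<omega>. ennreal \<bar>(\<Sum>i<N. indicator B (W i \<omega>)) / real N - (\<Sum>i<N. p i) / real N\<bar> \<partial>M)
    \<le> ennreal (1 / sqrt (real N))"
proof -
  define D where "D i \<omega> = indicator B (W i \<omega>) - p i" for i \<omega>
  have W[measurable]: "W i \<in> borel_measurable M" if "i < N" for i
    using ind that by (auto simp: indep_vars_def)
  have ind_int: "integrable M (\<lambda>\<omega>. indicator B (W i \<omega>) :: real)" if "i < N" for i
    using that by (intro integrable_const_bound[where B=1]) (auto simp: indicator_def)
  have p: "0 \<le> p i" "p i \<le> 1" if "i < N" for i
  proof -
    show "0 \<le> p i" unfolding p_def by (intro integral_nonneg_AE) auto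
    have "p i \<le> expectation (\<lambda>_. 1)" unfolding p_def
      using ind_int[OF that] by (intro integral_mono) (auto simp: indicator_def)
    then show "p i \<le> 1" by (simp add: prob_space)
  qed
  have D[measurable]: "D i \<in> borel_measurable M" if "i < N" for i
    using that unfolding D_def by measurable
  have D1: "\<bar>D i \<omega>\<bar> \<le> 1" if "i < N" for i \<omega>
    using p[OF that] by (auto simp: D_def indicator_def)
  have D_int: "integrable M (D i)" if "i < N" for i
    using that D1 by (intro integrable_const_bound[where B=1]) auto
  have D0: "expectation (D i) = 0" if "i < N" for i
    using ind_int[OF that] unfolding D_def by (subst Bochner_Integration.integral_diff) (auto simp: p_def prob_space)
  have DD_int: "integrable M (\<lambda>\<omega>. D i \<omega> * D j \<omega>)" if "i < N" "j < N" for i j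
    using that D1 by (intro integrable_const_bound[where B=1]) (auto simp: abs_mult intro!: mult_le_one)
  have indD: "indep_vars (\<lambda>_. borel) D {..<N}"
    unfolding D_def by (rule indep_vars_compose2[OF ind]) measurable
  have DD: "expectation (\<lambda>\<omega>. D i \<omega> * D j \<omega>) \<le> (if i = j then 1 else 0)" if ij: "i < N" "j < N" for i j
  proof (cases "i = j")
    case True
    have "expectation (\<lambda>\<omega>. D i \<omega> * D j \<omega>) \<le> expectation (\<lambda>_. 1)"
    proof (rule integral_mono[OF DD_int[OF ij] integrable_const])
      show "D i \<omega> * D j \<omega> \<le> 1" for \<omega>
        using D1[OF ij(1), of \<omega>] True by (simp add: abs_square_le_1 flip: power2_eq_square)
    qed
    then show ?thesis using True by (simp add: prob_space)
  next
    case False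
    have "indep_vars (\<lambda>_. borel) D {i, j}"
      by (rule indep_vars_subset[OF indD]) (use ij in auto)
    from indep_vars_lebesgue_integral[OF _ this] have
      "expectation (\<lambda>\<omega>. \<Prod>k\<in>{i, j}. D k \<omega>) = (\<Prod>k\<in>{i, j}. expectation (D k))"
      using D_int ij by auto
    then show ?thesis using False D0[OF ij(1)] by simp
  qed
  define S where "S \<omega> = (\<Sum>i<N. D i \<omega>)" for \<omega>
  have S2: "(S \<omega>)\<^sup>2 = (\<Sum>i<N. \<Sum>j<N. D i \<omega> * D j \<omega>)" for \<omega>
    by (simp add: S_def power2_eq_square sum_product)
  have S2_int: "integrable M (\<lambda>\<omega>. (S \<omega>)\<^sup>2)"
    unfolding S2 using DD_int by (intro Bochner_Integration.integrable_sum) auto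
  have "expectation (\<lambda>\<omega>. (S \<omega>)\<^sup>2) = (\<Sum>i<N. \<Sum>j<N. expectation (\<lambda>\<omega>. D i \<omega> * D j \<omega>))"
    unfolding S2 using DD_int
    by (subst Bochner_Integration.integral_sum) (auto intro!: sum.cong Bochner_Integration.integral_sum)
  also have "\<dots> \<le> (\<Sum>i<N. \<Sum>j<N. if i = j then 1 else 0)"
    using DD by (intro sum_mono) auto
  also have "\<dots> = real N" by simp
  finally have ES2: "expectation (\<lambda>\<omega>. (S \<omega>)\<^sup>2) \<le> real N" .
  have S_int: "integrable M S" unfolding S_def using D_int by auto
  let ?s = "sqrt (real N)"
  have s: "?s > 0" "?s * ?s = real N" using N by auto
  \<comment> \<open>AM-GM: \<open>2 \<bar>S\<bar> \<le> ?s + S\<^sup>2 / ?s\<close>\<close>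
  have amgm: "\<bar>S \<omega>\<bar> \<le> (?s + (S \<omega>)\<^sup>2 / ?s) / 2" for \<omega>
  proof -
    have "0 \<le> (?s - \<bar>S \<omega>\<bar>)\<^sup>2" by simp
    then have "2 * \<bar>S \<omega>\<bar> * ?s \<le> ?s * ?s + (S \<omega>)\<^sup>2" by (simp add: power2_diff power2_eq_square algebra_simps)
    then have "2 * \<bar>S \<omega>\<bar> \<le> (?s * ?s + (S \<omega>)\<^sup>2) / ?s" using s by (simp add: pos_le_divide_eq)
    then show ?thesis using s(1) by (simp add: add_divide_distrib real_div_sqrt)
  qed
  have "expectation (\<lambda>\<omega>. \<bar>S \<omega>\<bar>) \<le> expectation (\<lambda>\<omega>. (?s + (S \<omega>)\<^sup>2 / ?s) / 2)"
    using S_int S2_int amgm by (intro integral_mono) auto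
  also have "\<dots> = (?s + expectation (\<lambda>\<omega>. (S \<omega>)\<^sup>2) / ?s) / 2"
    using S2_int by (simp add: prob_space)
  also have "\<dots> \<le> (?s + real N / ?s) / 2"
    using ES2 s by (intro divide_right_mono add_left_mono) auto
  also have "real N / ?s = ?s" using N by (simp add: real_div_sqrt)
  finally have ES: "expectation (\<lambda>\<omega>. \<bar>S \<omega>\<bar>) \<le> ?s" by simp
  have "(\<integral>\<^sup>+ \<omega>. ennreal \<bar>(\<Sum>i<N. indicator B (W i \<omega>)) / real N - (\<Sum>i<N. p i) / real N\<bar> \<partial>M)
      = (\<integral>\<^sup>+ \<omega>. ennreal (\<bar>S \<omega>\<bar> / real N) \<partial>M)"
    unfolding S_def D_def sum_subtractf by (simp add: diff_divide_distrib[symmetric])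
  also have "\<dots> = ennreal (expectation (\<lambda>\<omega>. \<bar>S \<omega>\<bar> / real N))"
    using S_int by (intro nn_integral_eq_integral) auto
  also have "\<dots> = ennreal (expectation (\<lambda>\<omega>. \<bar>S \<omega>\<bar>) / real N)" by simp
  also have "\<dots> \<le> ennreal (?s / real N)"
    using ES by (intro ennreal_leI divide_right_mono) auto
  also have "?s / real N = 1 / ?s" using s by (simp add: divide_simps)
  finally show ?thesis .
qed

lemma measure_empirical:
  assumes "N > 0" "B \<in> sets borel"
  shows "measure (empirical N x) B = (\<Sum>i<N. indicator B (x i)) / real N"
proof -
  have "emeasure (empirical N x) B = (\<Sum>i<N. ennreal (indicator B (x i))) / of_nat N"
    by (simp add: emeasure_empirical[OF assms] ennreal_indicator)
  also have "\<dots> = ennreal ((\<Sum>i<N. indicator B (x i)) / real N)"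
    using assms(1) by (intro sum_ennreal_divide_of_nat) auto
  finally show ?thesis by (simp add: measure_def sum_nonneg)
qed

lemma tail_first_moment_small:
  fixes \<nu> :: "'a::euclidean_space measure"
  assumes "P1 \<nu>" "e > 0"
  obtains R where "R \<ge> 0" "(\<integral>\<^sup>+ y. ennreal (norm y) * indicator {y. R < norm y} y \<partial>\<nu>) < ennreal e"
proof -
  have [measurable_cong]: "sets \<nu> = sets borel" using assms by (simp add: P1_def)
  have "(\<lambda>n::nat. \<integral>\<^sup>+ y. ennreal (norm y) * indicator {y. real n < norm y} y \<partial>\<nu>) \<longlonglongrightarrow> (\<integral>\<^sup>+ y. 0 \<partial>\<nu>)"
  proof (rule nn_integral_dominated_convergence[where w="\<lambda>y. ennreal (norm y)"])
    show "(\<integral>\<^sup>+ y. ennreal (norm y) \<partial>\<nu>) < \<infinity>" using assms by (simp add: P1_def)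
    show "AE y in \<nu>. (\<lambda>n::nat. ennreal (norm y) * indicator {y. real n < norm y} y) \<longlonglongrightarrow> 0"
    proof (intro AE_I2 tendsto_eventually)
      fix y
      obtain n0 :: nat where n0: "norm y \<le> real n0" using real_arch_simple by blast
      show "\<forall>\<^sub>F n in sequentially. ennreal (norm y) * indicator {y. real n < norm y} y = 0"
        using eventually_ge_at_top[of n0] by eventually_elim (use n0 in auto)
    qed
  qed (auto simp: indicator_def)
  then have "\<forall>\<^sub>F n in sequentially. (\<integral>\<^sup>+ y. ennreal (norm y) * indicator {y. real n < norm y} y \<partial>\<nu>) < ennreal e"
    using assms(2) by (intro order_tendstoD) auto
  then obtain n :: nat where "(\<integral>\<^sup>+ y. ennreal (norm y) * indicator {y. real n < norm y} y \<partial>\<nu>) < ennreal e"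
    by (auto simp: eventually_sequentially)
  then show thesis by (intro that[of "real n"]) auto
qed

text \<open>The rate depends only on the average \<open>\<nu>\<close> of the laws; this uniformity is what lets the
  laws of the individual samples depend on the particle configuration.\<close>

lemma W1_empirical_independent_samples:
  fixes \<nu> :: "'a::euclidean_space measure"
  assumes \<nu>: "P1 \<nu>" and e: "e > 0"
  shows "\<exists>N0>0. \<forall>N\<ge>N0. \<forall>(Q :: 'q measure) W. prob_space Q \<longrightarrow>
    prob_space.indep_vars Q (\<lambda>_. borel) W {..<N} \<longrightarrow>
    is_mixture N (\<lambda>i. distr Q borel (W i)) \<nu> \<longrightarrow>
    (\<integral>\<^sup>+ \<omega>. W1 (empirical N (\<lambda>i. W i \<omega>)) \<nu> \<partial>Q) \<le> ennreal e"
proof -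
  have \<nu>': "prob_space \<nu>" "sets \<nu> = sets borel" using \<nu> by (auto simp: P1_def)
  interpret \<nu>: prob_space \<nu> by fact
  \<comment> \<open>The budget \<open>e\<close> is split into four: the tail of
    \<open>\<nu>\<close>, the expected tail of the empirical measure, the cell diameter, and the
    deviation of the cell frequencies.\<close>
  obtain R where R: "R \<ge> 0"
    and tail: "(\<integral>\<^sup>+ y. ennreal (norm y) * indicator {y. R < norm y} y \<partial>\<nu>) < ennreal (e / 4)"
    using tail_first_moment_small[OF \<nu>, of "e / 4"] e by auto
  define T where "T y = ennreal (norm y) * indicator {y. R < norm y} y" for y :: 'a
  have T[measurable]: "T \<in> borel_measurable borel" unfolding T_def by measurable
  have e4: "e / 4 > 0" using e by simp
  obtain c :: "'a \<Rightarrow> 'a set" and J where J: "finite J" "\<And>y. c y \<in> J"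
    and c: "\<And>j. j \<in> J \<Longrightarrow> c -` {j} \<in> sets borel"
    and diam: "\<And>y z. c y = c z \<Longrightarrow> norm y \<le> R \<Longrightarrow> dist y z \<le> e / 4"
    by (rule ex_cells[OF e4, of R], rule that)
  have "(\<lambda>N. 1 / sqrt (real N)) \<longlonglongrightarrow> 0"
    by (intro tendsto_divide_0[OF tendsto_const] filterlim_at_top_imp_at_infinity
      filterlim_compose[OF sqrt_at_top] filterlim_real_sequentially)
  from tendsto_mult[OF tendsto_const this]
  have "(\<lambda>N. 2 * R * real (card J) * (1 / sqrt (real N))) \<longlonglongrightarrow> 2 * R * real (card J) * 0" .
  then have "\<forall>\<^sub>F N in sequentially. 2 * R * real (card J) * (1 / sqrt (real N)) < e / 4"
    using e by (intro order_tendstoD) auto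
  \<comment> \<open>\<open>R\<close> and \<open>J\<close> were fixed from \<open>\<nu>\<close> and
    \<open>e\<close> alone, so \<open>N1\<close> does not depend on the samples.\<close>
  then obtain N1 where N1: "\<And>N. N \<ge> N1 \<Longrightarrow> 2 * R * real (card J) * (1 / sqrt (real N)) < e / 4"
    by (auto simp: eventually_sequentially)
  show ?thesis
  proof (intro exI[of _ "max 1 N1"] conjI allI impI)
    fix N :: nat and Q :: "'q measure" and W :: "nat \<Rightarrow> 'q \<Rightarrow> 'a"
    assume "max 1 N1 \<le> N" and Q: "prob_space Q"
      and ind: "prob_space.indep_vars Q (\<lambda>_. borel) W {..<N}"
      and mix: "is_mixture N (\<lambda>i. distr Q borel (W i)) \<nu>"
    then have N: "N > 0" "N \<ge> N1" by auto
    interpret prob_space Q by fact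
    have W[measurable]: "W i \<in> borel_measurable Q" if "i < N" for i
      using ind that by (auto simp: indep_vars_def)
    define p :: "'a set \<Rightarrow> nat \<Rightarrow> real"
      where "p j i = expectation (\<lambda>\<omega>. indicator (c -` {j}) (W i \<omega>))" for j i
    \<comment> \<open>The mixture hypothesis turns the mass of a cell into the mean of the
      individual probabilities, which is the centring of the frequency bound.\<close>
    have freq: "measure \<nu> (c -` {j}) = (\<Sum>i<N. p j i) / real N" if j: "j \<in> J" for j
    proof -
      note [measurable] = c[OF j]
      have "emeasure \<nu> (c -` {j}) = (\<integral>\<^sup>+ y. indicator (c -` {j}) y \<partial>\<nu>)"
        using c[OF j] \<nu>'(2) by (subst nn_integral_indicator) auto
      also have "\<dots> = (\<Sum>i<N. \<integral>\<^sup>+ y. indicator (c -` {j}) y \<partial>distr Q borel (W i)) / of_nat N"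
        using is_mixtureD(4)[OF mix, of "indicator (c -` {j})"] c[OF j] by simp
      also have "(\<Sum>i<N. \<integral>\<^sup>+ y. indicator (c -` {j}) y \<partial>distr Q borel (W i)) = (\<Sum>i<N. ennreal (p j i))"
      proof (intro sum.cong refl)
        fix i assume "i \<in> {..<N}"
        then have i[measurable]: "W i \<in> borel_measurable Q" using W by auto
        have "(\<integral>\<^sup>+ y. indicator (c -` {j}) y \<partial>distr Q borel (W i)) = (\<integral>\<^sup>+ \<omega>. indicator (c -` {j}) (W i \<omega>) \<partial>Q)"
          by (subst nn_integral_distr) auto
        also have "\<dots> = (\<integral>\<^sup>+ \<omega>. ennreal (indicator (c -` {j}) (W i \<omega>)) \<partial>Q)"
          by (simp add: ennreal_indicator)
        also have "\<dots> = ennreal (p j i)"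
        proof -
          have m: "(\<lambda>\<omega>. indicator (c -` {j}) (W i \<omega>) :: real) \<in> borel_measurable Q" by measurable
          show ?thesis unfolding p_def
            by (intro nn_integral_eq_integral integrable_const_bound[where B=1] m) (auto simp: indicator_def)
        qed
        finally show "(\<integral>\<^sup>+ y. indicator (c -` {j}) y \<partial>distr Q borel (W i)) = ennreal (p j i)" .
      qed
      also have "\<dots> / of_nat N = ennreal ((\<Sum>i<N. p j i) / real N)"
        using N(1) by (intro sum_ennreal_divide_of_nat) (auto simp: p_def)
      finally show ?thesis by (simp add: measure_def sum_nonneg p_def)
    qed
    define d where "d j \<omega> = \<bar>(\<Sum>i<N. indicator (c -` {j}) (W i \<omega>)) / real N - (\<Sum>i<N. p j i) / real N\<bar>"
      for j \<omega>
    have d[measurable]: "d j \<in> borel_measurable Q" if "j \<in> J" for j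
    proof -
      note c[OF that, measurable]
      have "(\<lambda>\<omega>. \<Sum>i<N. indicator (c -` {j}) (W i \<omega>) :: real) \<in> borel_measurable Q"
      proof (rule borel_measurable_sum)
        fix i assume "i \<in> {..<N}"
        then have [measurable]: "W i \<in> borel_measurable Q" using W by auto
        show "(\<lambda>\<omega>. indicator (c -` {j}) (W i \<omega>) :: real) \<in> borel_measurable Q" by measurable
      qed
      then show ?thesis unfolding d_def by measurable
    qed
    have TW[measurable]: "(\<lambda>\<omega>. \<integral>\<^sup>+ y. T y \<partial>empirical N (\<lambda>i. W i \<omega>)) \<in> borel_measurable Q"
    proof -
      have "(\<lambda>\<omega>. \<Sum>i<N. T (W i \<omega>)) \<in> borel_measurable Q"
      proof (rule borel_measurable_sum)
        fix i assume "i \<in> {..<N}"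
        then have [measurable]: "W i \<in> borel_measurable Q" using W by auto
        show "(\<lambda>\<omega>. T (W i \<omega>)) \<in> borel_measurable Q" by measurable
      qed
      then show ?thesis by (simp add: nn_integral_empirical[OF N(1)] divide_ennreal_def)
    qed
    have dsum: "(\<integral>\<^sup>+ \<omega>. (\<Sum>j\<in>J. ennreal (d j \<omega>)) \<partial>Q) \<le> ennreal (real (card J) * (1 / sqrt (real N)))"
    proof -
      have "(\<integral>\<^sup>+ \<omega>. (\<Sum>j\<in>J. ennreal (d j \<omega>)) \<partial>Q) = (\<Sum>j\<in>J. \<integral>\<^sup>+ \<omega>. ennreal (d j \<omega>) \<partial>Q)"
        by (intro nn_integral_sum) measurable
      also have "\<dots> \<le> (\<Sum>j\<in>J. ennreal (1 / sqrt (real N)))"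
        unfolding d_def p_def by (intro sum_mono expectation_abs_frequency_deviation ind N(1) c)
      also have "\<dots> = ennreal (real (card J) * (1 / sqrt (real N)))"
        by (simp add: ennreal_mult[symmetric] ennreal_of_nat_eq_real_of_nat)
      finally show ?thesis .
    qed
    \<comment> \<open>The expected empirical tail equals the tail of \<open>\<nu>\<close> exactly,
      since the laws average to \<open>\<nu>\<close>. No tail bound on the individual laws is
      required, although single ones may spread far.\<close>
    have ET: "(\<integral>\<^sup>+ \<omega>. (\<integral>\<^sup>+ y. T y \<partial>empirical N (\<lambda>i. W i \<omega>)) \<partial>Q) = (\<integral>\<^sup>+ y. T y \<partial>\<nu>)"
    proof -
      have "(\<integral>\<^sup>+ \<omega>. (\<integral>\<^sup>+ y. T y \<partial>empirical N (\<lambda>i. W i \<omega>)) \<partial>Q) = (\<integral>\<^sup>+ \<omega>. (\<Sum>i<N. T (W i \<omega>)) / of_nat N \<partial>Q)"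
        by (simp add: nn_integral_empirical[OF N(1)])
      also have "\<dots> = (\<integral>\<^sup>+ \<omega>. (\<Sum>i<N. T (W i \<omega>)) \<partial>Q) / of_nat N"
        by (intro nn_integral_divide borel_measurable_sum measurable_compose[OF W T]) auto
      also have "(\<integral>\<^sup>+ \<omega>. (\<Sum>i<N. T (W i \<omega>)) \<partial>Q) = (\<Sum>i<N. \<integral>\<^sup>+ \<omega>. T (W i \<omega>) \<partial>Q)"
        by (intro nn_integral_sum measurable_compose[OF W T]) auto
      also have "\<dots> = (\<Sum>i<N. \<integral>\<^sup>+ y. T y \<partial>distr Q borel (W i))"
        by (intro sum.cong refl nn_integral_distr[symmetric]) (auto intro: W)
      also have "\<dots> / of_nat N = (\<integral>\<^sup>+ y. T y \<partial>\<nu>)"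
        by (rule is_mixtureD(4)[OF mix T, symmetric])
      finally show ?thesis .
    qed
    have "(\<integral>\<^sup>+ \<omega>. W1 (empirical N (\<lambda>i. W i \<omega>)) \<nu> \<partial>Q) \<le>
      (\<integral>\<^sup>+ \<omega>. ennreal (e / 4) + (\<integral>\<^sup>+ y. T y \<partial>empirical N (\<lambda>i. W i \<omega>)) + (\<integral>\<^sup>+ y. T y \<partial>\<nu>)
        + ennreal (2 * R) * (\<Sum>j\<in>J. ennreal (d j \<omega>)) \<partial>Q)"
    proof (rule nn_integral_mono)
      fix \<omega>
      have "W1 (empirical N (\<lambda>i. W i \<omega>)) \<nu> \<le> ennreal (e / 4) + (\<integral>\<^sup>+ y. T y \<partial>empirical N (\<lambda>i. W i \<omega>)) + (\<integral>\<^sup>+ y. T y \<partial>\<nu>)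
        + ennreal (2 * R * (\<Sum>j\<in>J. \<bar>measure (empirical N (\<lambda>i. W i \<omega>)) (c -` {j}) - measure \<nu> (c -` {j})\<bar>))"
        unfolding T_def using e R
        by (intro W1_cells_le[where c=c] prob_space_empirical sets_empirical \<nu>' J c diam) auto
      also have "(\<Sum>j\<in>J. \<bar>measure (empirical N (\<lambda>i. W i \<omega>)) (c -` {j}) - measure \<nu> (c -` {j})\<bar>) = (\<Sum>j\<in>J. d j \<omega>)"
        by (intro sum.cong refl) (simp add: d_def freq measure_empirical[OF N(1) c])
      also have "ennreal (2 * R * (\<Sum>j\<in>J. d j \<omega>)) = ennreal (2 * R) * (\<Sum>j\<in>J. ennreal (d j \<omega>))"
        using R by (subst sum_ennreal) (auto simp: d_def ennreal_mult sum_nonneg)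
      finally show "W1 (empirical N (\<lambda>i. W i \<omega>)) \<nu> \<le> ennreal (e / 4)
        + (\<integral>\<^sup>+ y. T y \<partial>empirical N (\<lambda>i. W i \<omega>)) + (\<integral>\<^sup>+ y. T y \<partial>\<nu>) + ennreal (2 * R) * (\<Sum>j\<in>J. ennreal (d j \<omega>))" .
    qed
    also have "\<dots> = ennreal (e / 4) + (\<integral>\<^sup>+ y. T y \<partial>\<nu>) + (\<integral>\<^sup>+ y. T y \<partial>\<nu>)
        + ennreal (2 * R) * (\<integral>\<^sup>+ \<omega>. (\<Sum>j\<in>J. ennreal (d j \<omega>)) \<partial>Q)"
      by (simp add: nn_integral_add nn_integral_cmult emeasure_space_1 ET)
    also have "\<dots> \<le> ennreal (e / 4) + ennreal (e / 4) + ennreal (e / 4)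
        + ennreal (2 * R) * ennreal (real (card J) * (1 / sqrt (real N)))"
      using tail unfolding T_def[symmetric]
      by (intro add_mono mult_left_mono dsum order_refl) auto
    also have "ennreal (2 * R) * ennreal (real (card J) * (1 / sqrt (real N)))
        = ennreal (2 * R * real (card J) * (1 / sqrt (real N)))"
      using R by (simp add: ennreal_mult[symmetric] mult.assoc)
    also have "ennreal (e / 4) + ennreal (e / 4) + ennreal (e / 4) + \<dots>
        \<le> ennreal (e / 4) + ennreal (e / 4) + ennreal (e / 4) + ennreal (e / 4)"
      using N1[OF N(2)] by (intro add_left_mono ennreal_leI) auto
    also have "\<dots> = ennreal e" using e by (simp flip: ennreal_plus)
    finally show "(\<integral>\<^sup>+ \<omega>. W1 (empirical N (\<lambda>i. W i \<omega>)) \<nu> \<partial>Q) \<le> ennreal e" .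
  qed simp
qed

section \<open>The Lipschitz estimate and the nonlinear evolution\<close>

lemma P1_imp_prob_algebra: "P1 \<mu> \<Longrightarrow> \<mu> \<in> space (prob_algebra borel)"
  by (simp add: P1_def space_prob_algebra)

lemma P1_return: "P1 (return borel 0)"
  by (simp add: P1_def prob_space_return nn_integral_return)

text \<open>(A2) controls \<open>f\<close> only at the origin and the point mass there. This bound
  keeps the Lipschitz estimate from that base point finite for every measure with finite first
  moment.\<close>

lemma W1_return_le:
  fixes \<mu> :: "'a::euclidean_space measure"
  assumes "P1 \<mu>"
  shows "W1 \<mu> (return borel 0) \<le> (\<integral>\<^sup>+ x. ennreal (norm x) \<partial>\<mu>)"
proof -
  interpret prob_space \<mu> using assms by (simp add: P1_def)
  have s[measurable_cong]: "sets \<mu> = sets borel" using assms by (simp add: P1_def)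
  have m[measurable]: "(\<lambda>x. (x, 0)) \<in> \<mu> \<rightarrow>\<^sub>M borel \<Otimes>\<^sub>M borel" by measurable
  define \<pi> where "\<pi> = distr \<mu> (borel \<Otimes>\<^sub>M borel) (\<lambda>x. (x, 0::'a))"
  have "distr \<pi> borel fst = \<mu>"
    unfolding \<pi>_def by (subst distr_distr) (auto simp: comp_def s intro!: distr_id2)
  moreover have "distr \<pi> borel snd = return borel 0"
    unfolding \<pi>_def by (subst distr_distr) (auto simp: comp_def distr_const)
  ultimately have "\<pi> \<in> couplings \<mu> (return borel 0)"
    by (simp add: couplings_def \<pi>_def prob_space_distr[OF m])
  then have "W1 \<mu> (return borel 0) \<le> (\<integral>\<^sup>+ p. ennreal (dist (fst p) (snd p)) \<partial>\<pi>)"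
    unfolding W1_def by (rule INF_lower)
  also have "\<dots> = (\<integral>\<^sup>+ x. ennreal (norm x) \<partial>\<mu>)"
    unfolding \<pi>_def by (subst nn_integral_distr) auto
  finally show ?thesis .
qed

lemma measurable_section:
  fixes f :: "'a::euclidean_space \<Rightarrow> 'a measure \<Rightarrow> 'z::euclidean_space \<Rightarrow> 'a"
  assumes "(\<lambda>(x, \<mu>, z). f x \<mu> z) \<in> borel \<Otimes>\<^sub>M prob_algebra borel \<Otimes>\<^sub>M borel \<rightarrow>\<^sub>M borel"
    and "P1 \<mu>"
  shows "(\<lambda>u. f (fst u) \<mu> (snd u)) \<in> borel \<Otimes>\<^sub>M borel \<rightarrow>\<^sub>M borel"
proof -
  have "(\<lambda>u. (fst u, \<mu>, snd u)) \<in> borel \<Otimes>\<^sub>M borel \<rightarrow>\<^sub>M borel \<Otimes>\<^sub>M prob_algebra borel \<Otimes>\<^sub>M borel"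
    using P1_imp_prob_algebra[OF assms(2)] by measurable
  from measurable_compose[OF this assms(1)] show ?thesis by simp
qed

text \<open>\<open>Dlip f\<close> is a supremum over an uncountable family and need not be measurable, but the
  Lipschitz estimate is only ever needed for a fixed pair of arguments and after integration
  in \<open>z\<close>. The added 1 makes the constant positive, so that the estimate also holds when the
  Wasserstein distance is infinite.\<close>

lemma nn_integral_Dlip_le:
  fixes f :: "real^'d \<Rightarrow> (real^'d) measure \<Rightarrow> real^'m \<Rightarrow> real^'d"
  assumes A1: "(\<integral>\<^sup>+ z. Dlip f z \<partial>\<theta>) < \<infinity>" and P: "P1 \<mu>1" "P1 \<mu>2"
    and [measurable]: "f x1 \<mu>1 \<in> borel_measurable \<theta>" "f x2 \<mu>2 \<in> borel_measurable \<theta>"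
  shows "(\<integral>\<^sup>+ z. ennreal (norm (f x1 \<mu>1 z - f x2 \<mu>2 z)) \<partial>\<theta>)
    \<le> ((\<integral>\<^sup>+ z. Dlip f z \<partial>\<theta>) + 1) * (ennreal (dist x1 x2) + W1 \<mu>1 \<mu>2)"
proof (cases "(x1, \<mu>1) = (x2, \<mu>2)")
  case True then show ?thesis by simp
next
  case False
  define a where "a z = ennreal (norm (f x1 \<mu>1 z - f x2 \<mu>2 z))" for z
  define b where "b = ennreal (dist x1 x2) + W1 \<mu>1 \<mu>2"
  let ?D = "\<integral>\<^sup>+ z. Dlip f z \<partial>\<theta>"
  have [measurable]: "a \<in> borel_measurable \<theta>" unfolding a_def by measurable
  have "a z / b \<le> Dlip f z" for z
    unfolding Dlip_def a_def b_def using False P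
    by (intro SUP_upper2[of "((x1, \<mu>1), (x2, \<mu>2))"]) auto
  then have "(\<integral>\<^sup>+ z. a z / b \<partial>\<theta>) \<le> ?D" by (intro nn_integral_mono)
  then have le: "(\<integral>\<^sup>+ z. a z \<partial>\<theta>) / b \<le> ?D" by (subst (asm) nn_integral_divide) auto
  \<comment> \<open>\<open>False\<close> alone does not exclude \<open>b = 0\<close>: that would
    need W1 to separate measures. In that case a positive numerator would make the quotient
    infinite, against (A1).\<close>
  consider "b = 0" | "b = \<top>" | "b \<noteq> 0" "b \<noteq> \<top>" by blast
  then have "(\<integral>\<^sup>+ z. a z \<partial>\<theta>) \<le> (?D + 1) * b"
  proof cases
    case 1
    then have "(\<integral>\<^sup>+ z. a z \<partial>\<theta>) = 0"
      using le A1 by (cases "(\<integral>\<^sup>+ z. a z \<partial>\<theta>) = 0") (auto simp: divide_ennreal_def ennreal_mult_top top_unique)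
    then show ?thesis by simp
  next
    case 2 then show ?thesis by (simp add: ennreal_mult_top)
  next
    case 3
    then have "(\<integral>\<^sup>+ z. a z \<partial>\<theta>) = (\<integral>\<^sup>+ z. a z \<partial>\<theta>) / b * b"
      by (simp add: ennreal_divide_times ennreal_divide_self less_top)
    also have "\<dots> \<le> (?D + 1) * b" using le by (intro mult_right_mono) (auto intro: order_trans)
    finally show ?thesis .
  qed
  then show ?thesis by (simp add: a_def b_def)
qed

lemma dist_matrix_vector_le:
  "dist (A *v x) (A *v y) \<le> onorm ((*v) A) * dist x (y :: real^'n)" for A :: "real^'n^'m"
  using onorm[OF matrix_vector_mul_bounded_linear[of A], of "x - y"]
  by (simp add: dist_norm matrix_vector_mult_diff_distrib)

lemma onorm_matrix_nonneg: "onorm ((*v) A) \<ge> 0" for A :: "real^'n^'m"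
  by (rule onorm_pos_le[OF matrix_vector_mul_bounded_linear])

lemma borel_measurable_matrix_vector [measurable]:
  "(\<lambda>x. A *v x) \<in> borel_measurable borel" for A :: "real^'n^'m"
  by (intro borel_measurable_continuous_onI linear_continuous_on matrix_vector_mul_bounded_linear)

text \<open>Synchronous coupling: both states are driven by the same \<open>z\<close>, so the noise
  matters only through the increment of \<open>f\<close>, whose mean (A1) controls.\<close>

lemma nn_integral_step_dist_le:
  fixes f :: "real^'d \<Rightarrow> (real^'d) measure \<Rightarrow> real^'m \<Rightarrow> real^'d" and A :: "real^'d^'d"
  assumes delta: "\<delta> > 0" and \<theta>: "prob_space \<theta>" "sets \<theta> = sets borel"
    and f: "(\<lambda>(x, \<mu>, z). f x \<mu> z) \<in> borel \<Otimes>\<^sub>M prob_algebra borel \<Otimes>\<^sub>M borel \<rightarrow>\<^sub>M borel"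
    and A1: "(\<integral>\<^sup>+ z. Dlip f z \<partial>\<theta>) < \<infinity>" and P: "P1 \<mu>1" "P1 \<mu>2"
  shows "(\<integral>\<^sup>+ z. ennreal (dist (A *v x1 + \<delta> *\<^sub>R f x1 \<mu>1 z) (A *v x2 + \<delta> *\<^sub>R f x2 \<mu>2 z)) \<partial>\<theta>)
    \<le> ennreal (onorm ((*v) A)) * ennreal (dist x1 x2)
      + ennreal \<delta> * (((\<integral>\<^sup>+ z. Dlip f z \<partial>\<theta>) + 1) * (ennreal (dist x1 x2) + W1 \<mu>1 \<mu>2))"
proof -
  note [measurable_cong] = \<theta>(2)
  interpret prob_space \<theta> by fact
  have m[measurable]: "f x \<mu> \<in> borel_measurable \<theta>" if "P1 \<mu>" for x \<mu>
    using measurable_compose[OF measurable_Pair1'[of x borel borel] measurable_section[OF f that]] by simp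
  note [measurable] = m[OF P(1)] m[OF P(2)]
  have "(\<integral>\<^sup>+ z. ennreal (dist (A *v x1 + \<delta> *\<^sub>R f x1 \<mu>1 z) (A *v x2 + \<delta> *\<^sub>R f x2 \<mu>2 z)) \<partial>\<theta>)
    \<le> (\<integral>\<^sup>+ z. ennreal (onorm ((*v) A)) * ennreal (dist x1 x2) + ennreal \<delta> * ennreal (norm (f x1 \<mu>1 z - f x2 \<mu>2 z)) \<partial>\<theta>)"
  proof (rule nn_integral_mono)
    fix z
    have "dist (A *v x1 + \<delta> *\<^sub>R f x1 \<mu>1 z) (A *v x2 + \<delta> *\<^sub>R f x2 \<mu>2 z)
      \<le> dist (A *v x1) (A *v x2) + dist (\<delta> *\<^sub>R f x1 \<mu>1 z) (\<delta> *\<^sub>R f x2 \<mu>2 z)"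
      by (rule dist_triangle_add)
    also have "dist (\<delta> *\<^sub>R f x1 \<mu>1 z) (\<delta> *\<^sub>R f x2 \<mu>2 z) = \<delta> * norm (f x1 \<mu>1 z - f x2 \<mu>2 z)"
      using delta by (simp add: dist_norm flip: scaleR_diff_right)
    also have "dist (A *v x1) (A *v x2) \<le> onorm ((*v) A) * dist x1 x2" by (rule dist_matrix_vector_le)
    finally have "ennreal (dist (A *v x1 + \<delta> *\<^sub>R f x1 \<mu>1 z) (A *v x2 + \<delta> *\<^sub>R f x2 \<mu>2 z))
      \<le> ennreal (onorm ((*v) A) * dist x1 x2 + \<delta> * norm (f x1 \<mu>1 z - f x2 \<mu>2 z))"
      by (intro ennreal_leI) auto
    also have "\<dots> = ennreal (onorm ((*v) A)) * ennreal (dist x1 x2) + ennreal \<delta> * ennreal (norm (f x1 \<mu>1 z - f x2 \<mu>2 z))"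
      using delta onorm_matrix_nonneg[of A] by (simp add: ennreal_mult)
    finally show "ennreal (dist (A *v x1 + \<delta> *\<^sub>R f x1 \<mu>1 z) (A *v x2 + \<delta> *\<^sub>R f x2 \<mu>2 z)) \<le> \<dots>" .
  qed
  also have "\<dots> = ennreal (onorm ((*v) A)) * ennreal (dist x1 x2)
      + ennreal \<delta> * (\<integral>\<^sup>+ z. ennreal (norm (f x1 \<mu>1 z - f x2 \<mu>2 z)) \<partial>\<theta>)"
    by (simp add: nn_integral_add nn_integral_cmult emeasure_space_1)
  also have "(\<integral>\<^sup>+ z. ennreal (norm (f x1 \<mu>1 z - f x2 \<mu>2 z)) \<partial>\<theta>)
    \<le> ((\<integral>\<^sup>+ z. Dlip f z \<partial>\<theta>) + 1) * (ennreal (dist x1 x2) + W1 \<mu>1 \<mu>2)"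
    by (rule nn_integral_Dlip_le[OF A1 P]) measurable
  finally show ?thesis by (simp add: add_left_mono mult_left_mono)
qed

text \<open>The iterates of \<open>Psi\<close> must stay in \<open>P1\<close> for (A1) to apply to
  them. The step is compared with the one from state 0 and the point mass at 0, which is
  \<open>\<delta> *\<^sub>R f 0 (return borel 0) z\<close> and integrable by (A2).\<close>

lemma P1_Psi:
  fixes f :: "real^'d \<Rightarrow> (real^'d) measure \<Rightarrow> real^'m \<Rightarrow> real^'d" and A :: "real^'d^'d"
  assumes delta: "\<delta> > 0" and \<theta>: "prob_space \<theta>" "sets \<theta> = sets borel"
    and f: "(\<lambda>(x, \<mu>, z). f x \<mu> z) \<in> borel \<Otimes>\<^sub>M prob_algebra borel \<Otimes>\<^sub>M borel \<rightarrow>\<^sub>M borel"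
    and A1: "(\<integral>\<^sup>+ z. Dlip f z \<partial>\<theta>) < \<infinity>"
    and A2: "(\<integral>\<^sup>+ z. ennreal (norm (f 0 (return borel 0) z)) \<partial>\<theta>) < \<infinity>"
    and \<mu>: "P1 \<mu>"
  shows "P1 (Psi A \<delta> f \<theta> \<mu>)"
proof -
  have \<mu>': "prob_space \<mu>" "sets \<mu> = sets borel" "(\<integral>\<^sup>+ x. ennreal (norm x) \<partial>\<mu>) < \<infinity>" using \<mu> by (auto simp: P1_def)
  note [measurable_cong] = \<mu>'(2) \<theta>(2)
  interpret \<mu>: prob_space \<mu> by fact
  interpret \<theta>: prob_space \<theta> by fact
  interpret pair_prob_space \<mu> \<theta> ..
  note [measurable] = measurable_section[OF f \<mu>]
  have m0: "f x \<nu> \<in> borel_measurable \<theta>" if "P1 \<nu>" for x \<nu>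
    using measurable_compose[OF measurable_Pair1'[of x borel borel] measurable_section[OF f that]] by simp
  note [measurable] = m0[OF \<mu>] m0[OF P1_return]
  define G where "G u = A *v fst u + \<delta> *\<^sub>R f (fst u) \<mu> (snd u)" for u
  have G[measurable]: "G \<in> borel \<Otimes>\<^sub>M borel \<rightarrow>\<^sub>M borel" unfolding G_def by measurable
  have Psi: "Psi A \<delta> f \<theta> \<mu> = distr (\<mu> \<Otimes>\<^sub>M \<theta>) borel G"
    unfolding Psi_def G_def by (simp add: case_prod_unfold)
  let ?a = "onorm ((*v) A)" and ?L = "(\<integral>\<^sup>+ z. Dlip f z \<partial>\<theta>) + 1" and ?w = "W1 \<mu> (return borel 0)"
  let ?c = "\<integral>\<^sup>+ z. ennreal (norm (f 0 (return borel 0) z)) \<partial>\<theta>"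
  have inner: "(\<integral>\<^sup>+ z. ennreal (norm (G (x, z))) \<partial>\<theta>)
      \<le> ennreal ?a * ennreal (norm x) + ennreal \<delta> * (?L * (ennreal (norm x) + ?w)) + ennreal \<delta> * ?c" for x
  proof -
    have "(\<integral>\<^sup>+ z. ennreal (norm (G (x, z))) \<partial>\<theta>) \<le>
      (\<integral>\<^sup>+ z. ennreal (dist (A *v x + \<delta> *\<^sub>R f x \<mu> z) (A *v 0 + \<delta> *\<^sub>R f 0 (return borel 0) z))
        + ennreal \<delta> * ennreal (norm (f 0 (return borel 0) z)) \<partial>\<theta>)"
    proof (rule nn_integral_mono)
      fix z
      have "norm (G (x, z)) \<le> dist (G (x, z)) (\<delta> *\<^sub>R f 0 (return borel 0) z) + norm (\<delta> *\<^sub>R f 0 (return borel 0) z)"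
        by (metis dist_0_norm dist_commute dist_triangle)
      also have "\<dots> = dist (A *v x + \<delta> *\<^sub>R f x \<mu> z) (A *v 0 + \<delta> *\<^sub>R f 0 (return borel 0) z) + \<delta> * norm (f 0 (return borel 0) z)"
        using delta by (simp add: G_def)
      finally have "ennreal (norm (G (x, z))) \<le> ennreal \<dots>" by (rule ennreal_leI)
      then show "ennreal (norm (G (x, z))) \<le> ennreal (dist (A *v x + \<delta> *\<^sub>R f x \<mu> z) (A *v 0 + \<delta> *\<^sub>R f 0 (return borel 0) z))
        + ennreal \<delta> * ennreal (norm (f 0 (return borel 0) z))"
        using delta by (simp add: ennreal_mult)
    qed
    also have "\<dots> = (\<integral>\<^sup>+ z. ennreal (dist (A *v x + \<delta> *\<^sub>R f x \<mu> z) (A *v 0 + \<delta> *\<^sub>R f 0 (return borel 0) z)) \<partial>\<theta>) + ennreal \<delta> * ?c"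
      by (simp add: nn_integral_add nn_integral_cmult)
    also have "\<dots> \<le> ennreal ?a * ennreal (dist x 0) + ennreal \<delta> * (?L * (ennreal (dist x 0) + ?w)) + ennreal \<delta> * ?c"
      by (intro add_right_mono nn_integral_step_dist_le[OF delta \<theta> f A1 \<mu> P1_return])
    finally show ?thesis by simp
  qed
  have "(\<integral>\<^sup>+ y. ennreal (norm y) \<partial>Psi A \<delta> f \<theta> \<mu>) = (\<integral>\<^sup>+ u. ennreal (norm (G u)) \<partial>(\<mu> \<Otimes>\<^sub>M \<theta>))"
    unfolding Psi by (subst nn_integral_distr) auto
  also have "\<dots> = (\<integral>\<^sup>+ x. \<integral>\<^sup>+ z. ennreal (norm (G (x, z))) \<partial>\<theta> \<partial>\<mu>)"
    by (subst \<theta>.nn_integral_fst[symmetric]) auto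
  also have "\<dots> \<le> (\<integral>\<^sup>+ x. ennreal ?a * ennreal (norm x) + ennreal \<delta> * (?L * (ennreal (norm x) + ?w)) + ennreal \<delta> * ?c \<partial>\<mu>)"
    by (intro nn_integral_mono inner)
  also have "\<dots> = ennreal ?a * (\<integral>\<^sup>+ x. ennreal (norm x) \<partial>\<mu>)
      + ennreal \<delta> * (?L * ((\<integral>\<^sup>+ x. ennreal (norm x) \<partial>\<mu>) + ?w)) + ennreal \<delta> * ?c"
    by (simp add: nn_integral_add nn_integral_cmult \<mu>.emeasure_space_1)
  also have "\<dots> < \<infinity>"
    using \<mu>'(3) A1 A2 W1_return_le[OF \<mu>] by (auto simp: ennreal_mult_less_top intro: le_less_trans)
  finally show ?thesis
    unfolding P1_def by (auto simp: Psi intro!: prob_space_distr)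
qed

section \<open>One step from a deterministic configuration\<close>

lemma indep_vars_PiM_components:
  assumes prob: "\<And>i. i \<in> I \<Longrightarrow> prob_space (P i)" and I: "I \<noteq> {}"
  shows "prob_space.indep_vars (PiM I P) P (\<lambda>i u. u i) I"
proof -
  interpret prob_space "PiM I P" by (rule prob_space_PiM[OF prob])
  have "distr (PiM I P) (PiM I P) (\<lambda>u. \<lambda>i\<in>I. u i) = distr (PiM I P) (PiM I P) (\<lambda>u. u)"
    by (intro distr_cong refl) (auto simp: space_PiM PiE_def extensional_restrict)
  also have "\<dots> = PiM I P" by (rule distr_id2) simp
  also have "\<dots> = PiM I (\<lambda>i. distr (PiM I P) (P i) (\<lambda>u. u i))"
    using prob by (intro PiM_cong refl) (simp add: distr_PiM_component)
  finally show ?thesis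
    using I by (subst indep_vars_iff_distr_eq_PiM') auto
qed

lemma (in prob_space) distr_pair_snd:
  assumes "sigma_finite_measure N"
  shows "distr (M \<Otimes>\<^sub>M N) N snd = N"
proof (rule measure_eqI)
  interpret N: sigma_finite_measure N by fact
  fix B assume "B \<in> sets (distr (M \<Otimes>\<^sub>M N) N snd)"
  then have B: "B \<in> sets N" by simp
  have "snd -` B \<inter> space (M \<Otimes>\<^sub>M N) = space M \<times> B"
    using sets.sets_into_space[OF B] by (auto simp: space_pair_measure)
  then show "emeasure (distr (M \<Otimes>\<^sub>M N) N snd) B = emeasure N B"
    using B by (simp add: emeasure_distr N.emeasure_pair_measure_Times emeasure_space_1)
qed simp

lemma ennreal_average_affine:
  assumes "N > 0"
  shows "(\<Sum>i<N. c * t i + b) / of_nat N = c * ((\<Sum>i<N. t i) / of_nat N) + (b::ennreal)"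
proof -
  have "(\<Sum>i<N. c * t i + b) / of_nat N = c * (\<Sum>i<N. t i) / of_nat N + (\<Sum>i<N. b) / of_nat N"
    by (simp add: sum.distrib sum_distrib_left divide_ennreal_def distrib_right)
  then show ?thesis using ennreal_average_const[OF assms] by (simp add: ennreal_times_divide)
qed

text \<open>The configuration is deterministic here and only the noise is averaged, so a
  near-optimal family can be picked separately for each \<open>x\<close>. The threshold comes from
  the law of large numbers for \<open>Psi A \<delta> f \<theta> \<mu>\<close> and is fixed before
  \<open>x\<close>.\<close>

lemma one_step_W1_le:
  fixes f :: "real^'d \<Rightarrow> (real^'d) measure \<Rightarrow> real^'m \<Rightarrow> real^'d" and A :: "real^'d^'d"
  assumes delta: "\<delta> > 0" and \<theta>: "prob_space \<theta>" "sets \<theta> = sets borel"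
    and f: "(\<lambda>(x, \<mu>, z). f x \<mu> z) \<in> borel \<Otimes>\<^sub>M prob_algebra borel \<Otimes>\<^sub>M borel \<rightarrow>\<^sub>M borel"
    and A1: "(\<integral>\<^sup>+ z. Dlip f z \<partial>\<theta>) < \<infinity>"
    and A2: "(\<integral>\<^sup>+ z. ennreal (norm (f 0 (return borel 0) z)) \<partial>\<theta>) < \<infinity>"
    and \<mu>: "P1 \<mu>" and e: "e > 0"
  defines "L \<equiv> (\<integral>\<^sup>+ z. Dlip f z \<partial>\<theta>) + 1"
  shows "\<exists>N0>0. \<forall>N\<ge>N0. \<forall>x.
    (\<integral>\<^sup>+ z. W1 (empirical N (\<lambda>i. A *v x i + \<delta> *\<^sub>R f (x i) (empirical N x) (z i))) (Psi A \<delta> f \<theta> \<mu>)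
        \<partial>PiM {..<N} (\<lambda>_. \<theta>))
      \<le> (ennreal (onorm ((*v) A)) + 2 * ennreal \<delta> * L) * W1 (empirical N x) \<mu> + ennreal e"
proof -
  note [measurable_cong] = \<theta>(2)
  interpret \<theta>: prob_space \<theta> by fact
  define \<nu> where "\<nu> = Psi A \<delta> f \<theta> \<mu>"
  have P\<nu>: "P1 \<nu>" unfolding \<nu>_def by (rule P1_Psi[OF delta \<theta> f A1 A2 \<mu>])
  define G where "G u = A *v fst u + \<delta> *\<^sub>R f (fst u) \<mu> (snd u)" for u
  note [measurable] = measurable_section[OF f \<mu>]
  have G[measurable]: "G \<in> borel \<Otimes>\<^sub>M borel \<rightarrow>\<^sub>M borel" unfolding G_def by measurable
  define a where "a = ennreal (onorm ((*v) A))"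
  define K where "K = a + 2 * ennreal \<delta> * L"
  define b where "b = a + ennreal \<delta> * L"
  \<comment> \<open>\<open>b\<close> is the factor for a displaced state; the further
    \<open>ennreal \<delta> * L\<close> pays for replacing the empirical measure by
    \<open>\<mu>\<close> inside \<open>f\<close>.\<close>
  have Kb: "K = b + ennreal \<delta> * L" by (simp add: K_def b_def distrib_right mult_2 add.assoc)
  have L: "L < \<top>" "L \<noteq> 0" using A1 by (auto simp: L_def)
  have "K < \<top>" using L by (simp add: K_def a_def ennreal_mult_less_top)
  moreover have "K \<noteq> 0" using L delta by (simp add: K_def)
  \<comment> \<open>Positivity of \<open>k\<close> allows the slack \<open>\<epsilon> / k\<close> in
    the choice of the coupling, which is at most \<open>\<epsilon>\<close> after one step.\<close>
  ultimately obtain k where k: "k > 0" "K = ennreal k"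
    by (cases K) auto
  obtain N0 where N0: "N0 > 0" and LLN: "\<And>N (Q :: (nat \<Rightarrow> (real^'d) \<times> (real^'m)) measure) W.
      N \<ge> N0 \<Longrightarrow> prob_space Q \<Longrightarrow> prob_space.indep_vars Q (\<lambda>_. borel) W {..<N} \<Longrightarrow>
      is_mixture N (\<lambda>i. distr Q borel (W i)) \<nu> \<Longrightarrow>
      (\<integral>\<^sup>+ \<omega>. W1 (empirical N (\<lambda>i. W i \<omega>)) \<nu> \<partial>Q) \<le> ennreal e"
    using W1_empirical_independent_samples[OF P\<nu> e, where 'q="nat \<Rightarrow> (real^'d) \<times> (real^'m)"] by metis
  have step: "(\<integral>\<^sup>+ z. W1 (empirical N (\<lambda>i. A *v x i + \<delta> *\<^sub>R f (x i) (empirical N x) (z i))) \<nu>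
        \<partial>PiM {..<N} (\<lambda>_. \<theta>)) \<le> K * W1 (empirical N x) \<mu> + ennreal e" if "N \<ge> N0" for N x
  proof (rule ennreal_le_epsilon)
    have N: "N > 0" using that N0 by simp
    let ?w = "W1 (empirical N x) \<mu>"
    fix \<epsilon> :: real assume fin: "K * ?w + ennreal e < \<top>" and \<epsilon>: "\<epsilon> > 0"
    have Px: "P1 (empirical N x)" by (rule P1_empirical[OF N])
    define F where "F i z = A *v x i + \<delta> *\<^sub>R f (x i) (empirical N x) z" for i z
    have F[measurable]: "F i \<in> borel_measurable borel" for i
    proof -
      have [measurable]: "f (x i) (empirical N x) \<in> borel_measurable borel"
        using measurable_compose[OF measurable_Pair1'[of "x i" borel borel] measurable_section[OF f Px]] by simp
      show ?thesis unfolding F_def by measurable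
    qed
    have "?w < \<top>" using fin k by (auto simp: ennreal_mult_less_top)
    then have "?w < ?w + ennreal (\<epsilon> / k)"
      using \<epsilon> k by (cases ?w) (auto simp: ennreal_less_iff simp flip: ennreal_plus)
    from W1_empirical_approx[OF N this] obtain q0 where mix0: "is_mixture N q0 \<mu>"
      and cost0: "(\<Sum>i<N. \<integral>\<^sup>+ z. ennreal (dist (x i) z) \<partial>q0 i) / of_nat N < ?w + ennreal (\<epsilon> / k)" .
    define q where "q i = (if i < N then q0 i else return borel 0)" for i
    have mix: "is_mixture N q \<mu>" using mix0 by (simp add: is_mixture_def q_def)
    have cost: "(\<Sum>i<N. \<integral>\<^sup>+ z. ennreal (dist (x i) z) \<partial>q i) / of_nat N \<le> ?w + ennreal (\<epsilon> / k)"
      using cost0 by (simp add: q_def)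
    have q: "prob_space (q i)" "sets (q i) = sets borel" for i
      using is_mixtureD(1,2)[OF mix0] by (auto simp: q_def prob_space_return)
    note [measurable_cong] = q(2)
    \<comment> \<open>A coordinate holds the starting point of companion \<open>i\<close> and the
      noise shared by companion and particle. Under the product \<open>Q\<close> these pairs are
      independent over \<open>i\<close>.\<close>
    define P where "P i = q i \<Otimes>\<^sub>M \<theta>" for i
    have P: "prob_space (P i)" for i
      unfolding P_def by (intro prob_space_pair q \<theta>)
    have sP[measurable_cong]: "sets (P i) = sets (borel \<Otimes>\<^sub>M borel)" for i
      unfolding P_def by (intro sets_pair_measure_cong q \<theta>)
    define Q where "Q = PiM {..<N} P"
    have Q: "prob_space Q" unfolding Q_def by (intro prob_space_PiM P)
    have comp[measurable]: "(\<lambda>u. u i) \<in> Q \<rightarrow>\<^sub>M borel \<Otimes>\<^sub>M borel" if "i < N" for i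
    proof -
      have "(\<lambda>u. u i) \<in> Q \<rightarrow>\<^sub>M P i" unfolding Q_def using that by (intro measurable_component_singleton) simp
      then show ?thesis by (simp add: measurable_cong_sets[OF refl sP])
    qed
    have dcomp: "distr Q (P i) (\<lambda>u. u i) = P i" if "i < N" for i
      unfolding Q_def using that P by (intro distr_PiM_component) auto
    have int_comp: "(\<integral>\<^sup>+ u. h (u i) \<partial>Q) = (\<integral>\<^sup>+ y. \<integral>\<^sup>+ z. h (y, z) \<partial>\<theta> \<partial>q i)"
      if i: "i < N" and h: "h \<in> borel_measurable (borel \<Otimes>\<^sub>M borel)" for i h
    proof -
      have hP: "h \<in> borel_measurable (P i)" using h by (simp add: measurable_cong_sets[OF sP refl])
      have "(\<integral>\<^sup>+ u. h (u i) \<partial>Q) = (\<integral>\<^sup>+ v. h v \<partial>distr Q (P i) (\<lambda>u. u i))"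
        using i hP unfolding Q_def by (intro nn_integral_distr[symmetric] measurable_component_singleton) auto
      also have "\<dots> = (\<integral>\<^sup>+ v. h v \<partial>P i)" by (simp add: dcomp[OF i])
      also have "\<dots> = (\<integral>\<^sup>+ y. \<integral>\<^sup>+ z. h (y, z) \<partial>\<theta> \<partial>q i)"
        using hP unfolding P_def by (rule \<theta>.nn_integral_fst[symmetric])
      finally show ?thesis .
    qed
    \<comment> \<open>The companion moves with the fixed measure \<open>\<mu>\<close> in place of
      the empirical one, so \<open>W i\<close> depends on coordinate \<open>i\<close> alone and
      independence survives the step.\<close>
    define W where "W i u = G (u i)" for i and u :: "nat \<Rightarrow> (real^'d) \<times> (real^'m)"
    have W[measurable]: "W i \<in> borel_measurable Q" if "i < N" for i
      unfolding W_def by (rule measurable_compose[OF comp[OF that] G])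
    have ne: "{..<N} \<noteq> {}" using N by (auto simp: lessThan_empty_iff)
    have ind: "prob_space.indep_vars Q P (\<lambda>i u. u i) {..<N}"
      unfolding Q_def using P ne by (intro indep_vars_PiM_components) auto
    have indW: "prob_space.indep_vars Q (\<lambda>_. borel) W {..<N}"
      unfolding W_def
      by (rule prob_space.indep_vars_compose2[OF Q ind]) (simp add: measurable_cong_sets[OF sP refl] G)
    \<comment> \<open>The law after a step with \<open>\<mu>\<close> held fixed is linear in the
      starting law. As the starting laws average to \<open>\<mu>\<close>, the new ones average to
      \<open>\<nu>\<close>.\<close>
    have mixW: "is_mixture N (\<lambda>i. distr Q borel (W i)) \<nu>"
      unfolding is_mixture_def
    proof (intro conjI allI impI ballI)
      show "prob_space (distr Q borel (W i))" if "i < N" for i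
        by (rule prob_space.prob_space_distr[OF Q W[OF that]])
      show "sets \<nu> = sets borel" using P\<nu> by (simp add: P1_def)
      fix g :: "real^'d \<Rightarrow> ennreal" assume g[measurable]: "g \<in> borel_measurable borel"
      have s\<mu>[measurable_cong]: "sets \<mu> = sets borel" using \<mu> by (simp add: P1_def)
      have \<nu>_distr: "\<nu> = distr (\<mu> \<Otimes>\<^sub>M \<theta>) borel G"
        unfolding \<nu>_def Psi_def G_def by (simp add: case_prod_unfold)
      have G': "G \<in> \<mu> \<Otimes>\<^sub>M \<theta> \<rightarrow>\<^sub>M borel"
        unfolding measurable_cong_sets[OF sets_pair_measure_cong[OF s\<mu> \<theta>(2)] refl] by (rule G)
      have G'': "G \<in> borel \<Otimes>\<^sub>M \<theta> \<rightarrow>\<^sub>M borel"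
        unfolding measurable_cong_sets[OF sets_pair_measure_cong[OF refl \<theta>(2)] refl] by (rule G)
      have "(\<integral>\<^sup>+ y. g y \<partial>\<nu>) = (\<integral>\<^sup>+ u. g (G u) \<partial>(\<mu> \<Otimes>\<^sub>M \<theta>))"
        unfolding \<nu>_distr using nn_integral_distr[OF G', of g] by simp
      also have "\<dots> = (\<integral>\<^sup>+ y. \<integral>\<^sup>+ z. g (G (y, z)) \<partial>\<theta> \<partial>\<mu>)"
        by (rule \<theta>.nn_integral_fst[symmetric]) (rule measurable_compose[OF G' g])
      also have "\<dots> = (\<Sum>i<N. \<integral>\<^sup>+ y. \<integral>\<^sup>+ z. g (G (y, z)) \<partial>\<theta> \<partial>q i) / of_nat N"
        by (intro is_mixtureD(4)[OF mix] \<theta>.borel_measurable_nn_integral_fst[OF measurable_compose[OF G'' g]])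
      also have "(\<Sum>i<N. \<integral>\<^sup>+ y. \<integral>\<^sup>+ z. g (G (y, z)) \<partial>\<theta> \<partial>q i) = (\<Sum>i<N. \<integral>\<^sup>+ y. g y \<partial>distr Q borel (W i))"
      proof (intro sum.cong refl)
        fix i assume "i \<in> {..<N}"
        then have i: "i < N" by simp
        have "(\<integral>\<^sup>+ y. g y \<partial>distr Q borel (W i)) = (\<integral>\<^sup>+ u. g (G (u i)) \<partial>Q)"
          using W[OF i] by (subst nn_integral_distr) (auto simp: W_def)
        then show "(\<integral>\<^sup>+ y. \<integral>\<^sup>+ z. g (G (y, z)) \<partial>\<theta> \<partial>q i) = (\<integral>\<^sup>+ y. g y \<partial>distr Q borel (W i))"
          using int_comp[OF i, of "\<lambda>v. g (G v)"] by simp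
      qed
      finally show "(\<integral>\<^sup>+ y. g y \<partial>\<nu>) = (\<Sum>i<N. \<integral>\<^sup>+ y. g y \<partial>distr Q borel (W i)) / of_nat N" .
    qed simp
    \<comment> \<open>Forgetting the starting points turns \<open>Q\<close> into the pure noise law,
      so the integral in the claim can be lifted to \<open>Q\<close>, where the companions
      live.\<close>
    have noise: "distr Q (PiM {..<N} (\<lambda>_. \<theta>)) (\<lambda>u. \<lambda>i\<in>{..<N}. snd (u i)) = PiM {..<N} (\<lambda>_. \<theta>)"
    proof -
      have snd_P: "snd \<in> P i \<rightarrow>\<^sub>M \<theta>" for i unfolding P_def by simp
      have "prob_space.indep_vars Q (\<lambda>_. \<theta>) (\<lambda>i u. snd (u i)) {..<N}"
        by (rule prob_space.indep_vars_compose2[OF Q ind snd_P])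
      then have "distr Q (PiM {..<N} (\<lambda>_. \<theta>)) (\<lambda>u. \<lambda>i\<in>{..<N}. snd (u i))
          = PiM {..<N} (\<lambda>i. distr Q \<theta> (\<lambda>u. snd (u i)))"
        by (subst (asm) prob_space.indep_vars_iff_distr_eq_PiM'[OF Q ne])
          (auto simp: measurable_cong_sets[OF refl \<theta>(2)] intro: measurable_compose[OF comp])
      also have "\<dots> = PiM {..<N} (\<lambda>_. \<theta>)"
      proof (intro PiM_cong refl)
        fix i assume "i \<in> {..<N}"
        then have i: "i < N" by simp
        have "distr Q \<theta> (\<lambda>u. snd (u i)) = distr (distr Q (P i) (\<lambda>u. u i)) \<theta> snd"
          using i snd_P unfolding Q_def by (subst distr_distr) (auto simp: comp_def)
        also have "\<dots> = \<theta>"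
          unfolding dcomp[OF i] unfolding P_def
          by (rule prob_space.distr_pair_snd[OF q(1) \<theta>.sigma_finite_measure_axioms])
        finally show "distr Q \<theta> (\<lambda>u. snd (u i)) = \<theta>" .
      qed
      finally show ?thesis .
    qed
    have meas_snd: "(\<lambda>u. \<lambda>i\<in>{..<N}. snd (u i)) \<in> Q \<rightarrow>\<^sub>M PiM {..<N} (\<lambda>_. \<theta>)"
      by (intro measurable_restrict) (auto simp: measurable_cong_sets[OF refl \<theta>(2)] intro: measurable_compose[OF comp])
    have meas_H: "(\<lambda>z. W1 (empirical N (\<lambda>i. F i (z i))) \<nu>) \<in> borel_measurable (PiM {..<N} (\<lambda>_. \<theta>))"
    proof (rule borel_measurable_W1_empirical[OF N])
      fix i assume "i < N"
      then have "(\<lambda>z. z i) \<in> PiM {..<N} (\<lambda>_. \<theta>) \<rightarrow>\<^sub>M \<theta>" by (intro measurable_component_singleton) simp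
      then show "(\<lambda>z. F i (z i)) \<in> borel_measurable (PiM {..<N} (\<lambda>_. \<theta>))"
        by (rule measurable_compose) measurable
    qed
    define d where "d i u = dist (F i (snd u)) (G u)" for i and u :: "(real^'d) \<times> (real^'m)"
    have d[measurable]: "d i \<in> borel_measurable (borel \<Otimes>\<^sub>M borel)" for i unfolding d_def by measurable
    have du[measurable]: "(\<lambda>u. d i (u i)) \<in> borel_measurable Q" if "i < N" for i
      by (rule measurable_compose[OF comp[OF that] d])
    have d_int: "(\<integral>\<^sup>+ u. ennreal (d i (u i)) \<partial>Q)
        \<le> b * (\<integral>\<^sup>+ y. ennreal (dist (x i) y) \<partial>q i) + ennreal \<delta> * L * ?w" if i: "i < N" for i
    proof -
      have "(\<integral>\<^sup>+ u. ennreal (d i (u i)) \<partial>Q) = (\<integral>\<^sup>+ y. \<integral>\<^sup>+ z. ennreal (d i (y, z)) \<partial>\<theta> \<partial>q i)"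
        by (rule int_comp[OF i]) measurable
      also have "\<dots> \<le> (\<integral>\<^sup>+ y. b * ennreal (dist (x i) y) + ennreal \<delta> * L * ?w \<partial>q i)"
      proof (rule nn_integral_mono)
        fix y
        have "(\<integral>\<^sup>+ z. ennreal (d i (y, z)) \<partial>\<theta>)
          \<le> a * ennreal (dist (x i) y) + ennreal \<delta> * (L * (ennreal (dist (x i) y) + ?w))"
          unfolding d_def F_def G_def a_def L_def fst_conv snd_conv
          by (rule nn_integral_step_dist_le[OF delta \<theta> f A1 Px \<mu>])
        also have "\<dots> = b * ennreal (dist (x i) y) + ennreal \<delta> * L * ?w"
          by (simp add: b_def distrib_left distrib_right mult.assoc add.assoc)
        finally show "(\<integral>\<^sup>+ z. ennreal (d i (y, z)) \<partial>\<theta>) \<le> \<dots>" .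
      qed
      also have "\<dots> = b * (\<integral>\<^sup>+ y. ennreal (dist (x i) y) \<partial>q i) + ennreal \<delta> * L * ?w"
        by (subst nn_integral_add, measurable, subst nn_integral_cmult)
          (auto simp: prob_space.emeasure_space_1[OF q(1)])
      finally show ?thesis .
    qed
    have "(\<integral>\<^sup>+ z. W1 (empirical N (\<lambda>i. F i (z i))) \<nu> \<partial>PiM {..<N} (\<lambda>_. \<theta>))
      = (\<integral>\<^sup>+ u. W1 (empirical N (\<lambda>i. F i ((\<lambda>i\<in>{..<N}. snd (u i)) i))) \<nu> \<partial>Q)"
      by (subst noise[symmetric]) (rule nn_integral_distr[OF meas_snd], simp add: noise meas_H)
    also have "\<dots> = (\<integral>\<^sup>+ u. W1 (empirical N (\<lambda>i. F i (snd (u i)))) \<nu> \<partial>Q)"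
      by (intro nn_integral_cong arg_cong2[where f=W1] empirical_cong N refl) simp
    also have "\<dots> \<le> (\<integral>\<^sup>+ u. (\<Sum>i<N. ennreal (d i (u i))) / of_nat N + W1 (empirical N (\<lambda>i. W i u)) \<nu> \<partial>Q)"
    proof (rule nn_integral_mono)
      fix u
      have "W1 (empirical N (\<lambda>i. F i (snd (u i)))) \<nu>
        \<le> ennreal ((\<Sum>i<N. dist (F i (snd (u i))) (W i u)) / real N) + W1 (empirical N (\<lambda>i. W i u)) \<nu>"
        by (rule W1_empirical_triangle[OF N])
      also have "ennreal ((\<Sum>i<N. dist (F i (snd (u i))) (W i u)) / real N) = (\<Sum>i<N. ennreal (d i (u i))) / of_nat N"
        using N by (subst sum_ennreal_divide_of_nat) (auto simp: d_def W_def)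
      finally show "W1 (empirical N (\<lambda>i. F i (snd (u i)))) \<nu>
        \<le> (\<Sum>i<N. ennreal (d i (u i))) / of_nat N + W1 (empirical N (\<lambda>i. W i u)) \<nu>" .
    qed
    also have "\<dots> = (\<integral>\<^sup>+ u. (\<Sum>i<N. ennreal (d i (u i))) / of_nat N \<partial>Q) + (\<integral>\<^sup>+ u. W1 (empirical N (\<lambda>i. W i u)) \<nu> \<partial>Q)"
    proof (rule nn_integral_add)
      have "(\<lambda>u. \<Sum>i<N. ennreal (d i (u i))) \<in> borel_measurable Q"
        by (intro borel_measurable_sum measurable_compose[OF du measurable_ennreal]) simp
      then show "(\<lambda>u. (\<Sum>i<N. ennreal (d i (u i))) / of_nat N) \<in> borel_measurable Q"
        by (simp add: divide_ennreal_def)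
      show "(\<lambda>u. W1 (empirical N (\<lambda>i. W i u)) \<nu>) \<in> borel_measurable Q"
        by (intro borel_measurable_W1_empirical[OF N] W)
    qed
    also have "(\<integral>\<^sup>+ u. (\<Sum>i<N. ennreal (d i (u i))) / of_nat N \<partial>Q) = (\<Sum>i<N. \<integral>\<^sup>+ u. ennreal (d i (u i)) \<partial>Q) / of_nat N"
      by (subst nn_integral_divide)
        (auto intro!: borel_measurable_sum measurable_compose[OF du measurable_ennreal] nn_integral_sum arg_cong2[where f="(/)"])
    also have "\<dots> \<le> (\<Sum>i<N. b * (\<integral>\<^sup>+ y. ennreal (dist (x i) y) \<partial>q i) + ennreal \<delta> * L * ?w) / of_nat N"
      by (intro divide_right_mono_ennreal sum_mono d_int) simp
    also have "\<dots> = b * ((\<Sum>i<N. \<integral>\<^sup>+ y. ennreal (dist (x i) y) \<partial>q i) / of_nat N) + ennreal \<delta> * L * ?w"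
      by (rule ennreal_average_affine[OF N])
    also have "\<dots> \<le> b * (?w + ennreal (\<epsilon> / k)) + ennreal \<delta> * L * ?w"
      by (intro add_right_mono mult_left_mono cost) simp
    also have "\<dots> = K * ?w + b * ennreal (\<epsilon> / k)"
      by (simp add: Kb distrib_left distrib_right ac_simps)
    also have "b * ennreal (\<epsilon> / k) \<le> K * ennreal (\<epsilon> / k)"
      by (intro mult_right_mono) (auto simp: Kb)
    also have "K * ennreal (\<epsilon> / k) = ennreal \<epsilon>"
      using k \<epsilon> by (simp add: ennreal_mult[symmetric])
    also have "(\<integral>\<^sup>+ u. W1 (empirical N (\<lambda>i. W i u)) \<nu> \<partial>Q) \<le> ennreal e"
      by (rule LLN[OF that Q indW mixW])
    finally show "(\<integral>\<^sup>+ z. W1 (empirical N (\<lambda>i. A *v x i + \<delta> *\<^sub>R f (x i) (empirical N x) (z i))) \<nu>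
        \<partial>PiM {..<N} (\<lambda>_. \<theta>)) \<le> K * ?w + ennreal e + ennreal \<epsilon>"
      by (simp add: F_def add_left_mono add_right_mono ac_simps)
  qed
  then show ?thesis using N0 unfolding K_def a_def \<nu>_def by blast
qed

section \<open>Independence of the past and the next noise\<close>

lemma (in prob_space) indep_sets_reindex:
  assumes "inj_on h I" "indep_sets E (h ` I)"
  shows "indep_sets (\<lambda>i. E (h i)) I"
proof (rule indep_setsI)
  show "E (h i) \<subseteq> events" if "i \<in> I" for i
    using assms(2) that by (auto simp: indep_sets_def)
  fix A J assume J: "J \<noteq> {}" "J \<subseteq> I" "finite J" "\<forall>j\<in>J. A j \<in> E (h j)"
  have inj: "inj_on h J" using assms(1) J(2) by (rule inj_on_subset)
  define A' where "A' k = A (the_inv_into J h k)" for k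
  have A': "A' (h j) = A j" if "j \<in> J" for j
    unfolding A'_def by (simp add: the_inv_into_f_f[OF inj that])
  have "prob (\<Inter>k\<in>h ` J. A' k) = (\<Prod>k\<in>h ` J. prob (A' k))"
    by (rule indep_setsD[OF assms(2)]) (use J A' in auto)
  moreover have "(\<Inter>k\<in>h ` J. A' k) = (\<Inter>j\<in>J. A j)"
    using A' by auto
  moreover have "(\<Prod>k\<in>h ` J. prob (A' k)) = (\<Prod>j\<in>J. prob (A j))"
    unfolding prod.reindex[OF inj] comp_def by (intro prod.cong refl) (simp add: A')
  ultimately show "prob (\<Inter>j\<in>J. A j) = (\<Prod>j\<in>J. prob (A j))" by (simp only:)
qed

text \<open>A finite nonempty intersection of events from the \<open>E i\<close> lies again in
  \<open>S\<close>, so independence from \<open>A\<close> applies to it as a whole, and mutual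
  independence of the \<open>E i\<close> factors the rest. \<open>None\<close> becomes the index of
  the initial data, \<open>Some\<close> that of the noises.\<close>

lemma (in prob_space) indep_sets_insert_None:
  assumes AS: "indep_set A S" and E: "indep_sets E I" and ES: "\<And>i. i \<in> I \<Longrightarrow> E i \<subseteq> S"
    and S: "\<And>a b. a \<in> S \<Longrightarrow> b \<in> S \<Longrightarrow> a \<inter> b \<in> S"
  shows "indep_sets (case_option A E) (insert None (Some ` I))"
proof (rule indep_setsI)
  show "(case i of None \<Rightarrow> A | Some x \<Rightarrow> E x) \<subseteq> events" if "i \<in> insert None (Some ` I)" for i
  proof (cases i)
    case None
    then show ?thesis using indep_setD_ev1[OF AS] by simp
  next
    case (Some k)
    then have "k \<in> I" using that by auto
    then show ?thesis using E Some by (simp add: indep_sets_def)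
  qed
  fix B J assume J: "J \<noteq> {}" "J \<subseteq> insert None (Some ` I)" "finite J"
    and B: "\<forall>j\<in>J. B j \<in> (case j of None \<Rightarrow> A | Some x \<Rightarrow> E x)"
  define K where "K = {k. Some k \<in> J}"
  have KI: "K \<subseteq> I" using J(2) by (auto simp: K_def)
  have finK: "finite K"
    using finite_vimageI[OF J(3), of Some] by (simp add: K_def vimage_def)
  have BE: "B (Some k) \<in> E k" if "k \<in> K" for k using B that by (auto simp: K_def)
  have prodK: "prob (\<Inter>k\<in>K. B (Some k)) = (\<Prod>k\<in>K. prob (B (Some k)))" if "K \<noteq> {}"
    by (rule indep_setsD[OF E KI that finK]) (use BE in auto)
  have interS: "(\<Inter>k\<in>L. B (Some k)) \<in> S" if "finite L" "L \<noteq> {}" "L \<subseteq> K" for L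
    using that
  proof (induction rule: finite_ne_induct)
    case (singleton k) then show ?case using BE ES KI by auto
  next
    case (insert k L)
    then have "B (Some k) \<in> S" "(\<Inter>k\<in>L. B (Some k)) \<in> S" using BE ES KI by blast+
    from S[OF this] show ?case by simp
  qed
  show "prob (\<Inter>j\<in>J. B j) = (\<Prod>j\<in>J. prob (B j))"
  proof (cases "None \<in> J")
    case False
    then have JK: "J = Some ` K" by (auto simp: K_def) (metis imageI mem_Collect_eq not_None_eq)
    then show ?thesis using prodK J(1) by (simp add: prod.reindex)
  next
    case True
    then have JK: "J = insert None (Some ` K)"
      by (auto simp: K_def) (metis imageI mem_Collect_eq not_None_eq)
    show ?thesis
    proof (cases "K = {}")
      case True then show ?thesis using JK by simp
    next
      case False
      have "prob (\<Inter>j\<in>J. B j) = prob (B None \<inter> (\<Inter>k\<in>K. B (Some k)))" by (simp add: JK)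
      also have "\<dots> = prob (B None) * prob (\<Inter>k\<in>K. B (Some k))"
        by (rule indep_setD[OF AS]) (use B JK interS[OF finK False] in auto)
      also have "\<dots> = (\<Prod>j\<in>J. prob (B j))"
        using finK by (simp add: JK prodK[OF False] prod.reindex)
      finally show ?thesis .
    qed
  qed
qed

text \<open>Independent pi-systems over disjoint index blocks generate independent sigma-algebras,
  so variables measurable for these have a product joint law. The blocks of interest are the past of
  the system and the next noises.\<close>

lemma (in prob_space) distr_pair_collect_sigma:
  assumes E: "indep_sets E (I \<union> J)" and stable: "\<And>i. i \<in> I \<union> J \<Longrightarrow> Int_stable (E i)"
    and disj: "I \<inter> J = {}"
    and X: "X \<in> sigma (space M) (\<Union>i\<in>I. E i) \<rightarrow>\<^sub>M S" and Y: "Y \<in> sigma (space M) (\<Union>j\<in>J. E j) \<rightarrow>\<^sub>M T"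
  shows "X \<in> M \<rightarrow>\<^sub>M S" "Y \<in> M \<rightarrow>\<^sub>M T"
    and "distr M (S \<Otimes>\<^sub>M T) (\<lambda>\<omega>. (X \<omega>, Y \<omega>)) = distr M S X \<Otimes>\<^sub>M distr M T Y"
proof -
  have Ev: "E i \<subseteq> events" if "i \<in> I \<union> J" for i using E that by (auto simp: indep_sets_def)
  have pow: "(\<Union>i\<in>I. E i) \<subseteq> Pow (space M)" "(\<Union>i\<in>J. E i) \<subseteq> Pow (space M)"
    using Ev sets.sets_into_space by blast+
  have "indep_sets (\<lambda>b. sigma_sets (space M) (\<Union>i\<in>case_bool I J b. E i)) UNIV"
    by (rule indep_sets_collect_sigma)
      (use E stable disj in \<open>auto simp: UNIV_bool Un_commute disjoint_family_on_def split: bool.splits\<close>)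
  also have "(\<lambda>b. sigma_sets (space M) (\<Union>i\<in>case_bool I J b. E i))
    = case_bool (sigma_sets (space M) (\<Union>i\<in>I. E i)) (sigma_sets (space M) (\<Union>i\<in>J. E i))"
    by (auto simp: fun_eq_iff split: bool.splits)
  finally have ind: "indep_set (sigma_sets (space M) (\<Union>i\<in>I. E i)) (sigma_sets (space M) (\<Union>i\<in>J. E i))"
    by (simp add: indep_set_def)
  note ev = indep_setD_ev1[OF ind] indep_setD_ev2[OF ind]
  have sp: "space (sigma (space M) (\<Union>i\<in>I. E i)) = space M" "space (sigma (space M) (\<Union>j\<in>J. E j)) = space M"
    using pow by (auto simp: space_measure_of_conv)
  have st: "sets (sigma (space M) (\<Union>i\<in>I. E i)) = sigma_sets (space M) (\<Union>i\<in>I. E i)"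
    "sets (sigma (space M) (\<Union>j\<in>J. E j)) = sigma_sets (space M) (\<Union>j\<in>J. E j)"
    using pow by auto
  have ev': "sets (sigma (space M) (\<Union>i\<in>I. E i)) \<subseteq> events" "sets (sigma (space M) (\<Union>j\<in>J. E j)) \<subseteq> events"
    unfolding st by (rule ev)+
  show X': "X \<in> M \<rightarrow>\<^sub>M S" by (rule subsetD[OF measurable_mono[OF order_refl refl ev'(1) sp(1)] X])
  show Y': "Y \<in> M \<rightarrow>\<^sub>M T" by (rule subsetD[OF measurable_mono[OF order_refl refl ev'(2) sp(2)] Y])
  interpret X: prob_space "distr M S X" by (rule prob_space_distr[OF X'])
  interpret Y: prob_space "distr M T Y" by (rule prob_space_distr[OF Y'])
  have XY: "(\<lambda>\<omega>. (X \<omega>, Y \<omega>)) \<in> M \<rightarrow>\<^sub>M S \<Otimes>\<^sub>M T" using X' Y' by (rule measurable_Pair)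
  show "distr M (S \<Otimes>\<^sub>M T) (\<lambda>\<omega>. (X \<omega>, Y \<omega>)) = distr M S X \<Otimes>\<^sub>M distr M T Y"
  proof (rule pair_measure_eqI[symmetric])
    show "sigma_finite_measure (distr M S X)" "sigma_finite_measure (distr M T Y)" by unfold_locales
    show "sets (distr M S X \<Otimes>\<^sub>M distr M T Y) = sets (distr M (S \<Otimes>\<^sub>M T) (\<lambda>\<omega>. (X \<omega>, Y \<omega>)))"
      unfolding sets_distr by (intro sets_pair_measure_cong sets_distr)
    fix A B assume "A \<in> sets (distr M S X)" "B \<in> sets (distr M T Y)"
    then have A: "A \<in> sets S" and B: "B \<in> sets T" by auto
    have "prob ((X -` A \<inter> space M) \<inter> (Y -` B \<inter> space M)) = prob (X -` A \<inter> space M) * prob (Y -` B \<inter> space M)"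
      using measurable_sets[OF X A] measurable_sets[OF Y B]
      by (intro indep_setD[OF ind]) (auto simp: sp st)
    moreover have "(\<lambda>\<omega>. (X \<omega>, Y \<omega>)) -` (A \<times> B) \<inter> space M = (X -` A \<inter> space M) \<inter> (Y -` B \<inter> space M)" by auto
    ultimately show "emeasure (distr M S X) A * emeasure (distr M T Y) B
      = emeasure (distr M (S \<Otimes>\<^sub>M T) (\<lambda>\<omega>. (X \<omega>, Y \<omega>))) (A \<times> B)"
      using A B X' Y' XY by (simp add: emeasure_distr emeasure_eq_measure ennreal_mult)
  qed
qed

section \<open>Propagation of chaos\<close>

text \<open>By independence of configuration and next noise, Fubini turns the expectation into an
  iterated integral whose inner part, at a frozen configuration, is what \<open>bound\<close>
  estimates.\<close>

lemma (in prob_space) expected_W1_step_le: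
  fixes f :: "real^'d \<Rightarrow> (real^'d) measure \<Rightarrow> real^'m \<Rightarrow> real^'d" and A :: "real^'d^'d"
    and Y :: "nat \<Rightarrow> 'a \<Rightarrow> real^'d" and \<xi> :: "nat \<Rightarrow> 'a \<Rightarrow> real^'m"
  assumes \<theta>: "prob_space \<theta>" "sets \<theta> = sets borel"
    and f: "(\<lambda>(x, \<mu>, z). f x \<mu> z) \<in> borel \<Otimes>\<^sub>M prob_algebra borel \<Otimes>\<^sub>M borel \<rightarrow>\<^sub>M borel"
    and N: "N > 0"
    and bound: "\<And>x. (\<integral>\<^sup>+ z. W1 (empirical N (\<lambda>i. A *v x i + \<delta> *\<^sub>R f (x i) (empirical N x) (z i))) \<nu>
        \<partial>PiM {..<N} (\<lambda>_. \<theta>)) \<le> K * W1 (empirical N x) \<mu> + c"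
    and Y: "(\<lambda>\<omega>. \<lambda>i\<in>{..<N}. Y i \<omega>) \<in> M \<rightarrow>\<^sub>M PiM {..<N} (\<lambda>_. borel)"
    and \<xi>: "(\<lambda>\<omega>. \<lambda>i\<in>{..<N}. \<xi> i \<omega>) \<in> M \<rightarrow>\<^sub>M PiM {..<N} (\<lambda>_. \<theta>)"
    and ind: "distr M (PiM {..<N} (\<lambda>_. borel) \<Otimes>\<^sub>M PiM {..<N} (\<lambda>_. \<theta>))
        (\<lambda>\<omega>. ((\<lambda>i\<in>{..<N}. Y i \<omega>), (\<lambda>i\<in>{..<N}. \<xi> i \<omega>)))
      = distr M (PiM {..<N} (\<lambda>_. borel)) (\<lambda>\<omega>. \<lambda>i\<in>{..<N}. Y i \<omega>)
        \<Otimes>\<^sub>M distr M (PiM {..<N} (\<lambda>_. \<theta>)) (\<lambda>\<omega>. \<lambda>i\<in>{..<N}. \<xi> i \<omega>)"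
    and noise: "distr M (PiM {..<N} (\<lambda>_. \<theta>)) (\<lambda>\<omega>. \<lambda>i\<in>{..<N}. \<xi> i \<omega>) = PiM {..<N} (\<lambda>_. \<theta>)"
  shows "(\<integral>\<^sup>+ \<omega>. W1 (empirical N (\<lambda>i. A *v Y i \<omega> + \<delta> *\<^sub>R f (Y i \<omega>) (empirical N (\<lambda>j. Y j \<omega>)) (\<xi> i \<omega>))) \<nu> \<partial>M)
    \<le> K * (\<integral>\<^sup>+ \<omega>. W1 (empirical N (\<lambda>i. Y i \<omega>)) \<mu> \<partial>M) + c"
proof -
  define S where "S = PiM {..<N} (\<lambda>_. borel :: (real^'d) measure)"
  define T where "T = PiM {..<N} (\<lambda>_. \<theta>)"
  define x where "x \<omega> = (\<lambda>i\<in>{..<N}. Y i \<omega>)" for \<omega>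
  define z where "z \<omega> = (\<lambda>i\<in>{..<N}. \<xi> i \<omega>)" for \<omega>
  have x: "x \<in> M \<rightarrow>\<^sub>M S" and z: "z \<in> M \<rightarrow>\<^sub>M T"
    using Y \<xi> unfolding x_def z_def S_def T_def by auto
  have joint: "distr M (S \<Otimes>\<^sub>M T) (\<lambda>\<omega>. (x \<omega>, z \<omega>)) = distr M S x \<Otimes>\<^sub>M T"
    using ind unfolding noise unfolding x_def z_def S_def T_def .
  interpret T: prob_space T unfolding T_def by (intro prob_space_PiM \<theta>)
  define H where "H u = W1 (empirical N (\<lambda>i. A *v fst u i + \<delta> *\<^sub>R f (fst u i) (empirical N (fst u)) (snd u i))) \<nu>"
    for u :: "(nat \<Rightarrow> real^'d) \<times> (nat \<Rightarrow> real^'m)"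
  \<comment> \<open>The empirical measure is an argument of \<open>f\<close>, so joint measurability
    requires it to be a measurable map into \<open>prob_algebra borel\<close>.\<close>
  have H: "H \<in> borel_measurable (S \<Otimes>\<^sub>M T)"
    unfolding H_def
  proof (rule borel_measurable_W1_empirical[OF N])
    have fi[measurable]: "(\<lambda>u. fst u i) \<in> borel_measurable (S \<Otimes>\<^sub>M T)" if "i < N" for i
      using that unfolding S_def by (intro measurable_compose[OF measurable_fst] measurable_component_singleton) simp
    have se: "(\<lambda>u. snd u i) \<in> borel_measurable (S \<Otimes>\<^sub>M T)" if "i < N" for i
    proof -
      have "(\<lambda>u. snd u i) \<in> S \<Otimes>\<^sub>M T \<rightarrow>\<^sub>M \<theta>"
        using that unfolding T_def by (intro measurable_compose[OF measurable_snd] measurable_component_singleton) simp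
      then show ?thesis by (simp add: measurable_cong_sets[OF refl \<theta>(2)])
    qed
    have em: "(\<lambda>u. empirical N (fst u)) \<in> S \<Otimes>\<^sub>M T \<rightarrow>\<^sub>M prob_algebra borel"
      using measurable_empirical[OF N, of "\<lambda>i u. fst u i" "S \<Otimes>\<^sub>M T"] fi by simp
    fix i assume i: "i < N"
    have "(\<lambda>u. f (fst u i) (empirical N (fst u)) (snd u i)) \<in> borel_measurable (S \<Otimes>\<^sub>M T)"
      using measurable_compose[OF measurable_Pair[OF fi[OF i] measurable_Pair[OF em se[OF i]]] f] by simp
    moreover have "(\<lambda>u. A *v fst u i) \<in> borel_measurable (S \<Otimes>\<^sub>M T)"
      by (rule measurable_compose[OF fi[OF i] borel_measurable_matrix_vector])
    ultimately show "(\<lambda>u. A *v fst u i + \<delta> *\<^sub>R f (fst u i) (empirical N (fst u)) (snd u i)) \<in> borel_measurable (S \<Otimes>\<^sub>M T)"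
      by (intro borel_measurable_add borel_measurable_scaleR borel_measurable_const)
  qed
  have W: "(\<lambda>x. W1 (empirical N x) \<mu>) \<in> borel_measurable S"
    unfolding S_def by (intro borel_measurable_W1_empirical[OF N] measurable_component_singleton) simp
  have ex: "empirical N (x \<omega>) = empirical N (\<lambda>i. Y i \<omega>)" for \<omega>
    by (rule empirical_cong[OF N]) (simp add: x_def)
  have "(\<integral>\<^sup>+ \<omega>. W1 (empirical N (\<lambda>i. A *v Y i \<omega> + \<delta> *\<^sub>R f (Y i \<omega>) (empirical N (\<lambda>j. Y j \<omega>)) (\<xi> i \<omega>))) \<nu> \<partial>M)
    = (\<integral>\<^sup>+ \<omega>. H (x \<omega>, z \<omega>) \<partial>M)"
  proof (rule nn_integral_cong)
    fix \<omega>
    have "empirical N (\<lambda>i. A *v x \<omega> i + \<delta> *\<^sub>R f (x \<omega> i) (empirical N (x \<omega>)) (z \<omega> i))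
      = empirical N (\<lambda>i. A *v Y i \<omega> + \<delta> *\<^sub>R f (Y i \<omega>) (empirical N (\<lambda>j. Y j \<omega>)) (\<xi> i \<omega>))"
      unfolding ex by (rule empirical_cong[OF N]) (simp add: x_def z_def)
    then show "W1 (empirical N (\<lambda>i. A *v Y i \<omega> + \<delta> *\<^sub>R f (Y i \<omega>) (empirical N (\<lambda>j. Y j \<omega>)) (\<xi> i \<omega>))) \<nu>
      = H (x \<omega>, z \<omega>)" by (simp add: H_def)
  qed
  also have "\<dots> = (\<integral>\<^sup>+ u. H u \<partial>(distr M S x \<Otimes>\<^sub>M T))"
    unfolding joint[symmetric] using nn_integral_distr[OF measurable_Pair[OF x z], of H] H by simp
  also have "\<dots> = (\<integral>\<^sup>+ v. \<integral>\<^sup>+ w. H (v, w) \<partial>T \<partial>distr M S x)"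
  proof (rule T.nn_integral_fst[symmetric])
    show "H \<in> borel_measurable (distr M S x \<Otimes>\<^sub>M T)"
      unfolding measurable_cong_sets[OF sets_pair_measure_cong[OF sets_distr refl] refl] by (rule H)
  qed
  also have "\<dots> \<le> (\<integral>\<^sup>+ v. K * W1 (empirical N v) \<mu> + c \<partial>distr M S x)"
    unfolding H_def T_def fst_conv snd_conv by (intro nn_integral_mono bound)
  also have "\<dots> = (\<integral>\<^sup>+ \<omega>. K * W1 (empirical N (x \<omega>)) \<mu> + c \<partial>M)"
    by (rule nn_integral_distr[OF x]) (use W in simp)
  also have "\<dots> = K * (\<integral>\<^sup>+ \<omega>. W1 (empirical N (x \<omega>)) \<mu> \<partial>M) + c"
    using measurable_compose[OF x W] by (simp add: nn_integral_add nn_integral_cmult emeasure_space_1)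
  finally show ?thesis unfolding ex .
qed

theorem theorem3p1:
  fixes A :: "real^'d^'d" and \<delta> :: real
    and \<theta> :: "(real^'m) measure"
    and f :: "real^'d \<Rightarrow> (real^'d) measure \<Rightarrow> real^'m \<Rightarrow> real^'d"
    and M :: "'\<omega> measure"
    and \<mu>0 :: "(real^'d) measure"
    and X :: "nat \<Rightarrow> nat \<Rightarrow> nat \<Rightarrow> '\<omega> \<Rightarrow> real^'d"
    and \<epsilon> :: "nat \<Rightarrow> nat \<Rightarrow> '\<omega> \<Rightarrow> real^'m"
  assumes delta_pos: "\<delta> > 0"
    and theta: "prob_space \<theta>" "sets \<theta> = sets borel"
    and f_meas: "(\<lambda>(x, \<mu>, z). f x \<mu> z) \<in> borel \<Otimes>\<^sub>M prob_algebra borel \<Otimes>\<^sub>M borel \<rightarrow>\<^sub>M borel"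
    and A1: "(\<integral>\<^sup>+ z. Dlip f z \<partial>\<theta>) < \<infinity>"
    and A2: "(\<integral>\<^sup>+ z. ennreal (norm (f 0 (return borel 0) z)) \<partial>\<theta>) < \<infinity>"
    and M: "prob_space M"
    and mu0: "P1 \<mu>0"
    \<comment> \<open>initial conditions X N 0 i, i < N: random variables with law mu0, exchangeable for each N\<close>
    and X0_meas: "\<And>N i. i < N \<Longrightarrow> X N 0 i \<in> borel_measurable M"
    and X0_law: "\<And>N i. i < N \<Longrightarrow> distr M borel (X N 0 i) = \<mu>0"
    and X0_exch: "\<And>N p. p permutes {..<N} \<Longrightarrow>
        distr M (PiM {..<N} (\<lambda>_. borel)) (\<lambda>\<omega>. \<lambda>i\<in>{..<N}. X N 0 (p i) \<omega>)
      = distr M (PiM {..<N} (\<lambda>_. borel)) (\<lambda>\<omega>. \<lambda>i\<in>{..<N}. X N 0 i \<omega>)"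
    \<comment> \<open>noise eps i n (i >= 0, n >= 1): i.i.d. with law theta, independent of all initial conditions\<close>
    and eps_meas: "\<And>i n. \<epsilon> i n \<in> borel_measurable M"
    and eps_law: "\<And>i n. n \<ge> 1 \<Longrightarrow> distr M borel (\<epsilon> i n) = \<theta>"
    and eps_indep: "prob_space.indep_vars M (\<lambda>_. borel) (\<lambda>(i, n). \<epsilon> i n) (UNIV \<times> {1..})"
    and eps_X0_indep: "prob_space.indep_set M
        (sets (vimage_algebra (space M) (\<lambda>\<omega>. \<lambda>(N, i)\<in>{(N, i). i < N}. X N 0 i \<omega>)
                 (PiM {(N, i). i < N} (\<lambda>_. borel))))
        (sets (vimage_algebra (space M) (\<lambda>\<omega>. \<lambda>(i, n)\<in>UNIV \<times> {1..}. \<epsilon> i n \<omega>)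
                 (PiM (UNIV \<times> {1..}) (\<lambda>_. borel))))"
    \<comment> \<open>particle dynamics\<close>
    and X_step: "\<And>N n i \<omega>. i < N \<Longrightarrow>
        X N (Suc n) i \<omega> = A *v X N n i \<omega>
          + \<delta> *\<^sub>R f (X N n i \<omega>) (empirical N (\<lambda>j. X N n j \<omega>)) (\<epsilon> i (Suc n) \<omega>)"
    and init_conv: "(\<lambda>N. \<integral>\<^sup>+ \<omega>. W1 (empirical N (\<lambda>i. X N 0 i \<omega>)) \<mu>0 \<partial>M) \<longlonglongrightarrow> 0"
  shows "\<forall>n. (\<lambda>N. \<integral>\<^sup>+ \<omega>. W1 (empirical N (\<lambda>i. X N n i \<omega>)) ((Psi A \<delta> f \<theta> ^^ n) \<mu>0) \<partial>M)
              \<longlonglongrightarrow> 0"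
proof -
  interpret prob_space M by fact
  define XA where "XA = vimage_algebra (space M) (\<lambda>\<omega>. \<lambda>(N, i)\<in>{(N, i). i < N}. X N 0 i \<omega>)
                 (PiM {(N, i). i < N} (\<lambda>_. borel))"
  define EA where "EA = vimage_algebra (space M) (\<lambda>\<omega>. \<lambda>(i, n)\<in>UNIV \<times> {1..}. \<epsilon> i n \<omega>)
                 (PiM (UNIV \<times> {1..}) (\<lambda>_. borel))"
  have XAEA: "indep_set (sets XA) (sets EA)" using eps_X0_indep by (simp add: XA_def EA_def)
  have space_XA: "space XA = space M" and space_EA: "space EA = space M" by (auto simp: XA_def EA_def)
  have X0_XA: "X N 0 i \<in> borel_measurable XA" if "i < N" for N i
  proof -
    have 1: "(\<lambda>\<omega>. \<lambda>(N, i)\<in>{(N, i). i < N}. X N 0 i \<omega>) \<in> XA \<rightarrow>\<^sub>M PiM {(N, i). i < N} (\<lambda>_. borel)"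
      unfolding XA_def by (rule measurable_vimage_algebra1) (auto simp: space_PiM)
    have 2: "(\<lambda>v. v (N, i)) \<in> PiM {(N, i). i < N} (\<lambda>_. borel) \<rightarrow>\<^sub>M borel"
      using that by (intro measurable_component_singleton) simp
    from measurable_compose[OF 1 2] that show ?thesis by simp
  qed
  have eps_EA: "\<epsilon> i n \<in> borel_measurable EA" if "n \<ge> 1" for i n
  proof -
    have 1: "(\<lambda>\<omega>. \<lambda>(i, n)\<in>UNIV \<times> {1..}. \<epsilon> i n \<omega>) \<in> EA \<rightarrow>\<^sub>M PiM (UNIV \<times> {1..}) (\<lambda>_. borel)"
      unfolding EA_def by (rule measurable_vimage_algebra1) (auto simp: space_PiM)
    have 2: "(\<lambda>v. v (i, n)) \<in> PiM (UNIV \<times> {1..}) (\<lambda>_. borel) \<rightarrow>\<^sub>M borel"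
      using that by (intro measurable_component_singleton) simp
    from measurable_compose[OF 1 2] that show ?thesis by simp
  qed
  define E where "E = (\<lambda>(i, n). {\<epsilon> i n -` B \<inter> space M |B. B \<in> sets borel})"
  have E_indep: "indep_sets E (UNIV \<times> {1..})"
    using eps_indep unfolding indep_vars_def2 E_def by (simp add: case_prod_unfold)
  \<comment> \<open>\<open>None\<close> carries the sigma-algebra of all initial data, for every
    \<open>N\<close> together; \<open>Some (i, n)\<close> carries the events of a single noise
    variable. All are intersection stable, as needed to pass to generated sigma-algebras.\<close>
  define G where "G = case_option (sets XA) E"
  have G_indep: "indep_sets G (insert None (Some ` (UNIV \<times> {1..})))"
    unfolding G_def
  proof (rule indep_sets_insert_None[OF XAEA E_indep])
    show "E k \<subseteq> sets EA" if "k \<in> UNIV \<times> {1..}" for k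
      using that measurable_sets[OF eps_EA] by (auto simp: E_def space_EA)
  qed auto
  have G_stable: "Int_stable (G k)" for k
  proof (cases k)
    case None
    then show ?thesis by (auto simp: G_def Int_stable_def)
  next
    case (Some p)
    obtain i n where p: "p = (i, n)" by (cases p)
    show ?thesis
    proof (rule Int_stableI)
      fix a b assume "a \<in> G k" "b \<in> G k"
      then obtain B C where "B \<in> sets borel" "C \<in> sets borel"
        "a = \<epsilon> i n -` B \<inter> space M" "b = \<epsilon> i n -` C \<inter> space M"
        by (auto simp: G_def E_def Some p)
      then have "a \<inter> b = \<epsilon> i n -` (B \<inter> C) \<inter> space M" "B \<inter> C \<in> sets borel" by auto
      then have "a \<inter> b \<in> {\<epsilon> i n -` D \<inter> space M |D. D \<in> sets borel}" by blast
      then show "a \<inter> b \<in> G k" by (simp add: G_def E_def Some p)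
    qed
  qed
  \<comment> \<open>The noises of all particles up to time \<open>n\<close> are included, so
    \<open>past n\<close> serves every \<open>N\<close>. The noise with time index
    \<open>Suc n\<close> drives the step out of time \<open>n\<close> and is left out.\<close>
  define past :: "nat \<Rightarrow> (nat \<times> nat) option set" where "past n = insert None (Some ` (UNIV \<times> {1..n}))" for n
  define Past where "Past n = sigma (space M) (\<Union>k\<in>past n. G k)" for n
  have G_pow: "(\<Union>k\<in>K. G k) \<subseteq> Pow (space M)" if "K \<subseteq> insert None (Some ` (UNIV \<times> {1..}))" for K
  proof -
    have "G k \<subseteq> events" if "k \<in> K" for k
      using conjunct1[OF G_indep[unfolded indep_sets_def]] subsetD[OF \<open>K \<subseteq> _\<close> that] by (rule bspec)
    then show ?thesis using sets.sets_into_space by blast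
  qed
  have past_sub: "past n \<subseteq> insert None (Some ` (UNIV \<times> {1..}))" for n by (auto simp: past_def)
  have space_Past: "space (Past n) = space M"
    and sets_Past: "sets (Past n) = sigma_sets (space M) (\<Union>k\<in>past n. G k)" for n
    unfolding Past_def using G_pow[OF past_sub] by auto
  have eps_sigma: "\<epsilon> i n \<in> borel_measurable (sigma (space M) (\<Union>k\<in>K. G k))"
    if "Some (i, n) \<in> K" "K \<subseteq> insert None (Some ` (UNIV \<times> {1..}))" for i n K
  proof (rule measurableI)
    fix B :: "(real^'m) set" assume "B \<in> sets borel"
    then have "\<epsilon> i n -` B \<inter> space M \<in> (\<Union>k\<in>K. G k)"
      using that(1) by (intro UN_I[of "Some (i, n)"]) (auto simp: G_def E_def)
    then show "\<epsilon> i n -` B \<inter> space (sigma (space M) (\<Union>k\<in>K. G k)) \<in> sets (sigma (space M) (\<Union>k\<in>K. G k))"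
      using G_pow[OF that(2)] by auto
  qed simp
  have Past_mono: "h \<in> borel_measurable (Past (Suc n))" if "h \<in> borel_measurable (Past n)" for h :: "'\<omega> \<Rightarrow> real^'d" and n
  proof -
    have "sets (Past n) \<subseteq> sets (Past (Suc n))"
      unfolding sets_Past by (intro sigma_sets_subseteq UN_mono) (auto simp: past_def)
    then show ?thesis
      using that measurable_mono[of borel borel "Past n" "Past (Suc n)"] by (auto simp: space_Past)
  qed
  \<comment> \<open>Adaptedness is proved for all particles together, because each one feels the
    others through the empirical measure.\<close>
  have X_Past: "X N n i \<in> borel_measurable (Past n)" if "i < N" for N n i
    using that
  proof (induction n arbitrary: i)
    case 0
    have "sets XA \<subseteq> sets (Past 0)" unfolding sets_Past by (auto simp: past_def G_def)
    then show ?case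
      using X0_XA[OF 0] measurable_mono[of borel borel XA "Past 0"] by (auto simp: space_Past space_XA)
  next
    case (Suc n)
    then have N: "N > 0" by simp
    have X: "X N n j \<in> borel_measurable (Past (Suc n))" if "j < N" for j
      by (rule Past_mono[OF Suc.IH[OF that]])
    have "\<epsilon> i (Suc n) \<in> borel_measurable (Past (Suc n))"
      unfolding Past_def by (rule eps_sigma[OF _ past_sub]) (auto simp: past_def)
    from measurable_compose[OF measurable_Pair[OF X[OF Suc.prems] measurable_Pair[OF measurable_empirical[OF N X] this]] f_meas]
    have "(\<lambda>\<omega>. f (X N n i \<omega>) (empirical N (\<lambda>j. X N n j \<omega>)) (\<epsilon> i (Suc n) \<omega>)) \<in> borel_measurable (Past (Suc n))"
      by simp
    moreover have "(\<lambda>\<omega>. A *v X N n i \<omega>) \<in> borel_measurable (Past (Suc n))"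
      by (rule measurable_compose[OF X[OF Suc.prems] borel_measurable_matrix_vector])
    ultimately have "(\<lambda>\<omega>. A *v X N n i \<omega>
          + \<delta> *\<^sub>R f (X N n i \<omega>) (empirical N (\<lambda>j. X N n j \<omega>)) (\<epsilon> i (Suc n) \<omega>)) \<in> borel_measurable (Past (Suc n))"
      by (intro borel_measurable_add borel_measurable_scaleR borel_measurable_const)
    moreover have "X N (Suc n) i = (\<lambda>\<omega>. A *v X N n i \<omega>
          + \<delta> *\<^sub>R f (X N n i \<omega>) (empirical N (\<lambda>j. X N n j \<omega>)) (\<epsilon> i (Suc n) \<omega>))"
      using X_step[OF Suc.prems] by (rule ext)
    ultimately show ?case by simp
  qed
  have step_indep: "(\<lambda>\<omega>. \<lambda>i\<in>{..<N}. X N n i \<omega>) \<in> M \<rightarrow>\<^sub>M PiM {..<N} (\<lambda>_. borel)"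
      "(\<lambda>\<omega>. \<lambda>i\<in>{..<N}. \<epsilon> i (Suc n) \<omega>) \<in> M \<rightarrow>\<^sub>M PiM {..<N} (\<lambda>_. \<theta>)"
      "distr M (PiM {..<N} (\<lambda>_. borel) \<Otimes>\<^sub>M PiM {..<N} (\<lambda>_. \<theta>))
          (\<lambda>\<omega>. ((\<lambda>i\<in>{..<N}. X N n i \<omega>), (\<lambda>i\<in>{..<N}. \<epsilon> i (Suc n) \<omega>)))
        = distr M (PiM {..<N} (\<lambda>_. borel)) (\<lambda>\<omega>. \<lambda>i\<in>{..<N}. X N n i \<omega>)
          \<Otimes>\<^sub>M distr M (PiM {..<N} (\<lambda>_. \<theta>)) (\<lambda>\<omega>. \<lambda>i\<in>{..<N}. \<epsilon> i (Suc n) \<omega>)" for N n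
  proof -
    let ?J = "Some ` (UNIV \<times> {Suc n}) :: (nat \<times> nat) option set"
    have ind: "indep_sets G (past n \<union> ?J)"
      by (rule indep_sets_mono_index[OF _ G_indep]) (auto simp: past_def)
    have disj: "past n \<inter> ?J = {}" by (auto simp: past_def)
    have X: "(\<lambda>\<omega>. \<lambda>i\<in>{..<N}. X N n i \<omega>) \<in> sigma (space M) (\<Union>k\<in>past n. G k) \<rightarrow>\<^sub>M PiM {..<N} (\<lambda>_. borel)"
      by (intro measurable_restrict) (use X_Past in \<open>simp add: Past_def\<close>)
    have "\<epsilon> i (Suc n) \<in> sigma (space M) (\<Union>k\<in>?J. G k) \<rightarrow>\<^sub>M \<theta>" for i
      unfolding measurable_cong_sets[OF refl theta(2)] by (rule eps_sigma) auto
    then have \<epsilon>: "(\<lambda>\<omega>. \<lambda>i\<in>{..<N}. \<epsilon> i (Suc n) \<omega>)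
        \<in> sigma (space M) (\<Union>k\<in>?J. G k) \<rightarrow>\<^sub>M PiM {..<N} (\<lambda>_. \<theta>)"
      by (intro measurable_restrict)
    note pair = distr_pair_collect_sigma[OF ind G_stable disj X \<epsilon>]
    show "(\<lambda>\<omega>. \<lambda>i\<in>{..<N}. X N n i \<omega>) \<in> M \<rightarrow>\<^sub>M PiM {..<N} (\<lambda>_. borel)" by (rule pair(1))
    show "(\<lambda>\<omega>. \<lambda>i\<in>{..<N}. \<epsilon> i (Suc n) \<omega>) \<in> M \<rightarrow>\<^sub>M PiM {..<N} (\<lambda>_. \<theta>)" by (rule pair(2))
    show "distr M (PiM {..<N} (\<lambda>_. borel) \<Otimes>\<^sub>M PiM {..<N} (\<lambda>_. \<theta>))
          (\<lambda>\<omega>. ((\<lambda>i\<in>{..<N}. X N n i \<omega>), (\<lambda>i\<in>{..<N}. \<epsilon> i (Suc n) \<omega>)))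
        = distr M (PiM {..<N} (\<lambda>_. borel)) (\<lambda>\<omega>. \<lambda>i\<in>{..<N}. X N n i \<omega>)
          \<Otimes>\<^sub>M distr M (PiM {..<N} (\<lambda>_. \<theta>)) (\<lambda>\<omega>. \<lambda>i\<in>{..<N}. \<epsilon> i (Suc n) \<omega>)" by (rule pair(3))
  qed
  have noise: "distr M (PiM {..<N} (\<lambda>_. \<theta>)) (\<lambda>\<omega>. \<lambda>i\<in>{..<N}. \<epsilon> i (Suc n) \<omega>) = PiM {..<N} (\<lambda>_. \<theta>)"
    if N: "N > 0" for N n
  proof -
    have ne: "{..<N} \<noteq> {}" using N by (auto simp: lessThan_empty_iff)
    have rv: "\<epsilon> i (Suc n) \<in> M \<rightarrow>\<^sub>M \<theta>" for i
      unfolding measurable_cong_sets[OF refl theta(2)] by (rule eps_meas)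
    have "indep_sets (\<lambda>i. E (i, Suc n)) {..<N}"
      by (rule indep_sets_reindex[where h="\<lambda>i. (i, Suc n)"])
        (auto intro: inj_onI indep_sets_mono_index[OF _ E_indep])
    then have "indep_vars (\<lambda>_. \<theta>) (\<lambda>i. \<epsilon> i (Suc n)) {..<N}"
      unfolding indep_vars_def2 using rv by (simp add: E_def theta(2))
    then have "distr M (PiM {..<N} (\<lambda>_. \<theta>)) (\<lambda>\<omega>. \<lambda>i\<in>{..<N}. \<epsilon> i (Suc n) \<omega>)
        = PiM {..<N} (\<lambda>i. distr M \<theta> (\<epsilon> i (Suc n)))"
      using indep_vars_iff_distr_eq_PiM'[OF ne, of "\<lambda>i. \<epsilon> i (Suc n)" "\<lambda>_. \<theta>"] rv by simp
    also have "(\<lambda>i. distr M \<theta> (\<epsilon> i (Suc n))) = (\<lambda>_. \<theta>)"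
    proof (rule ext)
      fix i
      have "distr M \<theta> (\<epsilon> i (Suc n)) = distr M borel (\<epsilon> i (Suc n))"
        by (intro distr_cong refl theta(2))
      then show "distr M \<theta> (\<epsilon> i (Suc n)) = \<theta>" using eps_law[of "Suc n" i] by simp
    qed
    finally show ?thesis .
  qed
  have P1_iter: "P1 ((Psi A \<delta> f \<theta> ^^ n) \<mu>0)" for n
    by (induction n) (simp_all add: mu0 P1_Psi[OF delta_pos theta f_meas A1 A2])
  define K where "K = ennreal (onorm ((*v) A)) + 2 * ennreal \<delta> * ((\<integral>\<^sup>+ z. Dlip f z \<partial>\<theta>) + 1)"
  have K: "K < \<top>" using A1 by (simp add: K_def ennreal_mult_less_top)
  define w where "w = (\<lambda>n N. \<integral>\<^sup>+ \<omega>. W1 (empirical N (\<lambda>i. X N n i \<omega>)) ((Psi A \<delta> f \<theta> ^^ n) \<mu>0) \<partial>M)"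
  have rec: "\<forall>\<^sub>F N in sequentially. w (Suc n) N \<le> K * w n N + ennreal e" if "e > 0" for n and e :: real
  proof -
    let ?\<mu> = "(Psi A \<delta> f \<theta> ^^ n) \<mu>0"
    obtain N0 where N0: "N0 > 0" and bound: "\<And>N x. N \<ge> N0 \<Longrightarrow>
      (\<integral>\<^sup>+ z. W1 (empirical N (\<lambda>i. A *v x i + \<delta> *\<^sub>R f (x i) (empirical N x) (z i))) (Psi A \<delta> f \<theta> ?\<mu>)
        \<partial>PiM {..<N} (\<lambda>_. \<theta>)) \<le> K * W1 (empirical N x) ?\<mu> + ennreal e"
      using one_step_W1_le[OF delta_pos theta f_meas A1 A2 P1_iter[of n] \<open>e > 0\<close>, of A] unfolding K_def by blast
    have "w (Suc n) N \<le> K * w n N + ennreal e" if "N \<ge> N0" for N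
    proof -
      have N: "N > 0" using that N0 by simp
      have "w (Suc n) N = (\<integral>\<^sup>+ \<omega>. W1 (empirical N (\<lambda>i. A *v X N n i \<omega>
          + \<delta> *\<^sub>R f (X N n i \<omega>) (empirical N (\<lambda>j. X N n j \<omega>)) (\<epsilon> i (Suc n) \<omega>))) (Psi A \<delta> f \<theta> ?\<mu>) \<partial>M)"
        unfolding w_def funpow.simps comp_def
        by (intro nn_integral_cong arg_cong2[where f=W1] empirical_cong N X_step refl)
      also have "\<dots> \<le> K * (\<integral>\<^sup>+ \<omega>. W1 (empirical N (\<lambda>i. X N n i \<omega>)) ?\<mu> \<partial>M) + ennreal e"
        by (rule expected_W1_step_le[OF theta f_meas N bound[OF that] step_indep noise[OF N]])
      finally show ?thesis by (simp only: w_def)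
    qed
    then show ?thesis by (auto simp: eventually_sequentially)
  qed
  have "(w n) \<longlonglongrightarrow> 0" for n
  proof (induction n)
    case 0
    then show ?case using init_conv by (simp add: w_def)
  next
    case (Suc n)
    show ?case
    proof (rule order_tendstoI)
      fix a :: ennreal assume "0 < a"
      \<comment> \<open>\<open>a\<close> may be \<open>\<top>\<close>; the intermediate
        \<open>b\<close> is finite and supplies a real \<open>e\<close>, halved between the
        inductive term and the one-step error.\<close>
      then obtain b where b: "0 < b" "b < a" using dense by blast
      then obtain e where e: "e > 0" "ennreal e < a" by (cases b) auto
      have "(\<lambda>N. K * w n N) \<longlonglongrightarrow> K * 0" by (rule ennreal_tendsto_cmult[OF K Suc.IH])
      then have "\<forall>\<^sub>F N in sequentially. K * w n N < ennreal (e / 2)"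
        using e(1) by (intro order_tendstoD) auto
      moreover have "\<forall>\<^sub>F N in sequentially. w (Suc n) N \<le> K * w n N + ennreal (e / 2)"
        using e(1) by (intro rec) simp
      ultimately show "\<forall>\<^sub>F N in sequentially. w (Suc n) N < a"
      proof eventually_elim
        case (elim N)
        have "w (Suc n) N \<le> ennreal (e / 2) + ennreal (e / 2)"
          using elim by (meson add_right_mono less_imp_le order_trans)
        also have "\<dots> = ennreal e" using e(1) by (simp flip: ennreal_plus)
        also note e(2)
        finally show ?case .
      qed
    qed simp
  qed
  then show ?thesis unfolding w_def by blast
qed

end
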